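(* There are infinitely many (pairwise non-isomorphic) connected pentavalent symmetric graphs with a quasi-semiregular automorphism and an insolvable full automorphism group.
   Context: Graphs are finite, undirected and simple. A graph is symmetric if its full automorphism group is transitive on vertices and on arcs (ordered pairs of adjacent vertices). An automorphism $g\ne 1$ of a graph is quasi-semiregular if it fixes a unique vertex and all its cycles on the remaining vertices have the same length. Pentavalent means regular of valency $5$; insolvable means not solvable. *)

theory Defs
  imports
    "Graph_Theory.Pair_Digraph"
    "Graph_Theory.Digraph_Isomorphism"
    "HOL-Algebra.Bij"
    "HOL-Algebra.Solvable_Groups"
    "HOL-Combinatorics.Orbits"
begin

text \<open>A finite simple undirected graph is a \<open>pair_graph\<close>: its arcs form a finite, irreflexive,
  symmetric relation on its finite vertex set. An edge is thus a pair of opposite arcs, and the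
  valency of a vertex is its out-degree.\<close>

definition graph_automorphisms :: "'a pair_pre_digraph \<Rightarrow> ('a \<Rightarrow> 'a) set" where
  "graph_automorphisms G =
    {f \<in> Bij (pverts G). \<forall>u \<in> pverts G. \<forall>v \<in> pverts G.
       (f u, f v) \<in> parcs G \<longleftrightarrow> (u, v) \<in> parcs G}"

definition graph_aut_group :: "'a pair_pre_digraph \<Rightarrow> ('a \<Rightarrow> 'a) monoid" where
  "graph_aut_group G = BijGroup (pverts G) \<lparr>carrier := graph_automorphisms G\<rparr>"

lemma subgroup_graph_automorphisms:
  "subgroup (graph_automorphisms G) (BijGroup (pverts G))"
proof
  show "graph_automorphisms G \<subseteq> carrier (BijGroup (pverts G))"
    by (auto simp: graph_automorphisms_def BijGroup_def)
next
  fix f g assume "f \<in> graph_automorphisms G" "g \<in> graph_automorphisms G"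
  then show "f \<otimes>\<^bsub>BijGroup (pverts G)\<^esub> g \<in> graph_automorphisms G"
    using Bij_imp_funcset[of g "pverts G"]
    by (auto simp: graph_automorphisms_def BijGroup_def compose_Bij compose_eq Pi_iff)
next
  show "\<one>\<^bsub>BijGroup (pverts G)\<^esub> \<in> graph_automorphisms G"
    by (simp add: graph_automorphisms_def BijGroup_def id_Bij)
next
  fix f assume f: "f \<in> graph_automorphisms G"
  let ?h = "inv_into (pverts G) f"
  have B: "f \<in> Bij (pverts G)" using f by (simp add: graph_automorphisms_def)
  then have "f ` pverts G = pverts G" by (simp add: Bij_def bij_betw_def)
  then have "f (?h u) = u" if "u \<in> pverts G" for u
    using that by (simp add: f_inv_into_f)
  moreover have "?h u \<in> pverts G" if "u \<in> pverts G" for u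
    using B that by (rule Bij_inv_into_mem)
  moreover have "\<forall>u \<in> pverts G. \<forall>v \<in> pverts G. (f u, f v) \<in> parcs G \<longleftrightarrow> (u, v) \<in> parcs G"
    using f by (simp add: graph_automorphisms_def)
  ultimately have "(?h u, ?h v) \<in> parcs G \<longleftrightarrow> (u, v) \<in> parcs G"
    if "u \<in> pverts G" "v \<in> pverts G" for u v
    using that by metis
  then show "inv\<^bsub>BijGroup (pverts G)\<^esub> f \<in> graph_automorphisms G"
    using B by (simp add: graph_automorphisms_def inv_BijGroup restrict_inv_into_Bij)
qed

lemma group_graph_aut_group: "group (graph_aut_group G)"
  unfolding graph_aut_group_def
  by (rule subgroup.subgroup_is_group[OF subgroup_graph_automorphisms group_BijGroup])

definition vertex_transitive :: "'a pair_pre_digraph \<Rightarrow> bool" where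
  "vertex_transitive G \<longleftrightarrow>
    (\<forall>u \<in> pverts G. \<forall>v \<in> pverts G. \<exists>f \<in> carrier (graph_aut_group G). f u = v)"

definition arc_transitive :: "'a pair_pre_digraph \<Rightarrow> bool" where
  "arc_transitive G \<longleftrightarrow>
    (\<forall>(u, v) \<in> parcs G. \<forall>(x, y) \<in> parcs G.
       \<exists>f \<in> carrier (graph_aut_group G). f u = x \<and> f v = y)"

text \<open>The constant \<open>symmetric\<close> of \<open>Graph_Theory\<close> only says that the arc relation is symmetric; the
  following is the notion of algebraic graph theory.\<close>

definition symmetric_graph :: "'a pair_pre_digraph \<Rightarrow> bool" where
  "symmetric_graph G \<longleftrightarrow> vertex_transitive G \<and> arc_transitive G"

definition pentavalent :: "'a pair_pre_digraph \<Rightarrow> bool" where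
  "pentavalent G \<longleftrightarrow> (\<forall>v \<in> pverts G. out_degree (with_proj G) v = 5)"

text \<open>The length of the cycle of \<open>g\<close> through \<open>u\<close> is the cardinality of
  \<open>orbit g u = {g u, g (g u), \<dots>}\<close>, which contains \<open>u\<close> as \<open>g\<close> permutes the finite vertex set.\<close>

definition quasi_semiregular :: "'a pair_pre_digraph \<Rightarrow> ('a \<Rightarrow> 'a) \<Rightarrow> bool" where
  "quasi_semiregular G g \<longleftrightarrow>
    g \<in> carrier (graph_aut_group G) \<and> g \<noteq> \<one>\<^bsub>graph_aut_group G\<^esub> \<and>
    (\<exists>v \<in> pverts G. g v = v \<and> (\<forall>u \<in> pverts G - {v}. g u \<noteq> u) \<and>
       (\<forall>u \<in> pverts G - {v}. \<forall>w \<in> pverts G - {v}.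
          card (Orbits.orbit g u) = card (Orbits.orbit g w)))"

end

theory Submission
  imports Defs "HOL-Library.Function_Algebras" "HOL-Algebra.Sym_Groups"
begin

text \<open>The graphs are covers of the complete graph \<open>K\<^sub>6\<close> with abelian covering groups. The symmetric
group \<open>S\<^sub>5\<close>, acting as \<open>PGL(2,5)\<close> on the projective line over \<open>GF(5)\<close>, is arc-transitive on \<open>K\<^sub>6\<close>, and
an element of order 5 fixes one of the six points. A connected cover inherits this symmetry when
its voltages lie in a module on which \<open>S\<^sub>5\<close> acts compatibly. If the element of order 5 moreover has no
nonzero fixed vector in the module, then it acts on the covering group without nontrivial fixed
points, and its lift fixes exactly one vertex of the cover. Such a module is the set of zero-sum
vectors in \<open>(\<int>/n)\<^sup>5\<close>, with coordinates permuted and multiplied by the sign of the permutation,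
whenever \<open>n\<close> is coprime to 5: a vector fixed by a 5-cycle is constant, and its sum 5\<open>c\<close> is zero only
if \<open>c\<close> is zero.

Everything is visible inside \<open>\<int>\<^sup>5\<close>. There are 30 vectors with one entry 0, two entries 1 and two
entries -1, and they stand for the 30 arcs of \<open>K\<^sub>6\<close>. The five cyclic rotations of (0,1,-1,-1,1),
the sequence of values of the quadratic character modulo 5, form a block. Its images under signed
permutations are six disjoint blocks, which stand for the six points; for two distinct blocks \<open>P\<close>
and \<open>Q\<close> exactly one \<open>v \<in> P\<close> has \<open>-v \<in> Q\<close>, and this \<open>v\<close> is the voltage of the arc from \<open>P\<close> to \<open>Q\<close>
(\<open>block_orbit_explicit\<close>, \<open>negatives_in_block\<close>). The cover has the vertices \<open>(P, x)\<close>, where \<open>x\<close> is a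
zero-sum vector modulo \<open>n\<close>, and arcs from \<open>(P, x)\<close> to \<open>(Q, x + v)\<close>. Signed permutations together
with translations of \<open>x\<close> act on it, and since \<open>S\<^sub>5\<close> is transitive on the pairs of a block and a
vector in it, they are transitive on arcs (\<open>affine_arc_transitive\<close>).

The voltage of a triangle of \<open>K\<^sub>6\<close> is three times a difference of two unit vectors, so the cover is
connected if \<open>n\<close> is coprime to 3 (\<open>cover_connected\<close>). The 5-cycle is quasi-semiregular because its
order is the prime 5 and it fixes exactly one vertex (\<open>cover_quasi_semiregular\<close>). The automorphism
group contains \<open>S\<^sub>5\<close> and hence is insolvable (\<open>cover_not_solvable\<close>). Since \<open>n\<close> may be
any number above 1 coprime to 15, the numbers of vertices are unbounded, which gives infinitely
many isomorphism types.\<close>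

section \<open>Signed permutations of coordinates\<close>
text \<open>The tensor product of the permutation representation with the sign. The twist is what makes the
voltages antisymmetric: a transposition of two equal entries of a vector negates the vector.\<close>
definition signed_act :: "(nat \<Rightarrow> nat) \<Rightarrow> (nat \<Rightarrow> int) \<Rightarrow> nat \<Rightarrow> int" where
  "signed_act \<sigma> x = (\<lambda>i. sign \<sigma> * x (inv' \<sigma> i))"

lemma signed_act_eqI:
  assumes "\<sigma> permutes {1..5::nat}" "\<And>i. y (\<sigma> i) = sign \<sigma> * x i"
  shows "signed_act \<sigma> x = y"
proof
  fix i
  have "\<sigma> (inv' \<sigma> i) = i"
    using assms(1) by (simp add: permutes_inverses)
  then show "signed_act \<sigma> x i = y i"
    using assms(2)[of "inv' \<sigma> i"] by (simp add: signed_act_def)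
qed

lemma signed_act_apply:
  assumes "\<sigma> permutes {1..5::nat}"
  shows "signed_act \<sigma> x (\<sigma> i) = sign \<sigma> * x i"
  using assms by (simp add: signed_act_def permutes_inverses)

lemma signed_act_id [simp]: "signed_act id x = x" "signed_act (\<lambda>i. i) x = x"
  by (simp_all add: signed_act_def flip: id_def)

lemma signed_act_comp:
  assumes "\<sigma> permutes {1..5::nat}" "\<tau> permutes {1..5}"
  shows "signed_act (\<sigma> \<circ> \<tau>) x = signed_act \<sigma> (signed_act \<tau> x)"
proof (rule signed_act_eqI)
  show "\<sigma> \<circ> \<tau> permutes {1..5}"
    using assms by (simp add: permutes_compose)
  have "sign (\<sigma> \<circ> \<tau>) = sign \<sigma> * sign \<tau>"
    using assms by (intro sign_compose) (auto simp: permutation_permutes)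
  then show "signed_act \<sigma> (signed_act \<tau> x) ((\<sigma> \<circ> \<tau>) i) = sign (\<sigma> \<circ> \<tau>) * x i" for i
    using assms by (simp add: signed_act_apply)
qed

lemma signed_act_add: "signed_act \<sigma> (x + y) = signed_act \<sigma> x + signed_act \<sigma> y"
  and signed_act_zero [simp]: "signed_act \<sigma> 0 = 0"
  and signed_act_minus: "signed_act \<sigma> (- x) = - signed_act \<sigma> x"
  by (auto simp: signed_act_def fun_eq_iff distrib_left)

lemma signed_act_inv:
  assumes "\<sigma> permutes {1..5::nat}"
  shows "signed_act (inv' \<sigma>) (signed_act \<sigma> x) = x" "signed_act \<sigma> (signed_act (inv' \<sigma>) x) = x"
  using signed_act_comp[OF permutes_inv[OF assms] assms, of x] signed_act_comp[OF assms permutes_inv[OF assms], of x] assms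
  by (simp_all add: permutes_inv_o)

definition zero_sum :: "(nat \<Rightarrow> int) set" where
  "zero_sum = {x. (\<forall>i. i \<notin> {1..5} \<longrightarrow> x i = 0) \<and> (\<Sum>i=1..5. x i) = 0}"

lemma zero_sum_add: "x \<in> zero_sum \<Longrightarrow> y \<in> zero_sum \<Longrightarrow> x + y \<in> zero_sum"
  and zero_sum_minus: "x \<in> zero_sum \<Longrightarrow> - x \<in> zero_sum"
  and zero_sum_zero: "0 \<in> zero_sum"
  by (auto simp: zero_sum_def sum.distrib sum_negf)

lemma zero_sum_signed_act:
  assumes "\<sigma> permutes {1..5::nat}" "x \<in> zero_sum"
  shows "signed_act \<sigma> x \<in> zero_sum"
proof -
  have "(\<Sum>i=1..5. x (inv' \<sigma> i)) = (\<Sum>i=1..5. x i)"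
    using sum.permute[OF permutes_inv[OF assms(1)], of x] by (simp add: o_def)
  moreover have "inv' \<sigma> i = i" if "i \<notin> {1..5}" for i
    using permutes_inv[OF assms(1)] that by (meson permutes_def)
  ultimately show ?thesis
    using assms(2) by (auto simp: zero_sum_def signed_act_def simp flip: sum_distrib_left)
qed

section \<open>The blocks of a pentagon\<close>
text \<open>The cycle runs downwards so that it acts on coordinate lists as \<open>rotate1\<close>.\<close>
definition rot :: "nat \<Rightarrow> nat" where
  "rot = cycle_of_list [5, 4, 3, 2, 1]"

definition vector_of :: "int list \<Rightarrow> nat \<Rightarrow> int" where
  "vector_of l = (\<lambda>i. if i \<in> {1..5} then l ! (i - 1) else 0)"

lemma rot_permutes: "rot permutes {1..5}"
proof -
  have "rot permutes set [5, 4, 3, 2, 1]"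
    unfolding rot_def by (rule cycle_permutes)
  moreover have "set [5, 4, 3, 2, 1] = {1..5::nat}" by auto
  ultimately show ?thesis by simp
qed

lemma sign_rot: "sign rot = 1"
  by (simp add: rot_def sign_compose permutation_compose permutation_swap_id sign_swap_id)

lemma rot_apply:
  "rot i = (if i = 1 then 5 else if i \<in> {2..5} then i - 1 else i)"
proof (cases "i \<in> {1..5}")
  case True
  then have "i = 1 \<or> i = 2 \<or> i = 3 \<or> i = 4 \<or> i = 5" by auto
  then show ?thesis by (elim disjE) (simp_all add: rot_def)
next
  case False
  then show ?thesis
    using permutes_not_in[OF rot_permutes False] by auto
qed

lemma rot_power_5: "rot ^^ 5 = id"
proof
  fix i :: nat
  have "rot (rot (rot (rot (rot i)))) = i"
  proof (cases "i \<in> {1..5}")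
    case True
    then have "i = 1 \<or> i = 2 \<or> i = 3 \<or> i = 4 \<or> i = 5" by auto
    then show ?thesis by (elim disjE) (simp_all add: rot_apply)
  next
    case False
    then show ?thesis by (simp add: permutes_not_in[OF rot_permutes])
  qed
  then show "(rot ^^ 5) i = id i"
    by (simp add: numeral_eq_Suc)
qed

text \<open>Coordinates are numbered from 1 and list positions from 0, hence the shift of the index.\<close>
definition neg_swap :: "nat \<Rightarrow> nat \<Rightarrow> int list \<Rightarrow> int list" where
  "neg_swap a b l = map (\<lambda>i. - l ! (Transposition.transpose a b i - 1)) [1, 2, 3, 4, 5]"

lemma coordinates_eq: "{1..5::nat} = {1, 2, 3, 4, 5}"
  by auto

lemma signed_act_rot:
  assumes "length l = 5"
  shows "signed_act rot (vector_of l) = vector_of (rotate1 l)"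
proof (rule signed_act_eqI[OF rot_permutes])
  fix i
  obtain a b c d e where l: "l = [a, b, c, d, e]"
    using assms by (auto simp: length_Suc_conv numeral_eq_Suc)
  show "vector_of (rotate1 l) (rot i) = sign rot * vector_of l i"
  proof (cases "i \<in> {1..5}")
    case True
    then have "i = 1 \<or> i = 2 \<or> i = 3 \<or> i = 4 \<or> i = 5" by auto
    then show ?thesis
      unfolding l sign_rot by (elim disjE) (simp_all add: vector_of_def rot_apply)
  next
    case False
    then show ?thesis using permutes_not_in[OF rot_permutes False] by (simp add: vector_of_def del: atLeastAtMost_iff)
  qed
qed

lemma signed_act_transpose:
  assumes "a \<in> {1..5}" "b \<in> {1..5}" "a \<noteq> b" 
  shows "signed_act (Transposition.transpose a b) (vector_of l) = vector_of (neg_swap a b l)"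
proof (rule signed_act_eqI)
  show "Transposition.transpose a b permutes {1..5}"
    using assms by (intro permutes_swap_id)
  fix i
  have "vector_of (neg_swap a b l) j = - vector_of l (Transposition.transpose a b j)" for j
  proof (cases "j \<in> {1..5}")
    case True
    then have "Transposition.transpose a b j \<in> {1..5}"
      using assms by (auto simp: transpose_def)
    moreover have "neg_swap a b l ! (j - 1) = - l ! (Transposition.transpose a b j - 1)"
      using True unfolding coordinates_eq by (auto simp: neg_swap_def)
    ultimately show ?thesis
      using True by (simp add: vector_of_def)
  next
    case False
    then show ?thesis using assms by (auto simp: vector_of_def transpose_def)
  qed
  then show "vector_of (neg_swap a b l) (Transposition.transpose a b i) =
      sign (Transposition.transpose a b) * vector_of l i"
    using assms by (simp add: sign_swap_id)
qed

lemma inj_on_vector_of: "inj_on vector_of {l. length l = 5}"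
proof (rule inj_onI, clarsimp)
  fix k l :: "int list" assume len: "length k = 5" "length l = 5" and eq: "vector_of k = vector_of l"
  show "k = l"
  proof (rule nth_equalityI)
    fix i assume "i < length k"
    then show "k ! i = l ! i"
      using fun_cong[OF eq, of "Suc i"] len by (simp add: vector_of_def)
  qed (simp add: len)
qed

lemma minus_vector_of: "length l = 5 \<Longrightarrow> - vector_of l = vector_of (map uminus l)"
  by (auto simp: vector_of_def fun_eq_iff)

text \<open>The list holds the quadratic character modulo 5. Its rotation with 0 at the vertex \<open>a\<close> of a regular
pentagon is 1 at the neighbours of \<open>a\<close> and -1 at the two opposite vertices.\<close>
definition pentagon :: "int list list" where
  "pentagon = map (\<lambda>k. rotate k [0, 1, - 1, - 1, 1]) [0..<5]"

text \<open>The image of the base block under one transposition is a second block, and the 5-cycle permutes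
the five blocks other than the base block cyclically.\<close>
definition blocks :: "int list list list" where
  "blocks = pentagon # map (\<lambda>k. map (\<lambda>l. rotate k (neg_swap 1 2 l)) pentagon) [0..<5]"

lemma blocks_length: "\<forall>B \<in> set blocks. \<forall>l \<in> set B. length l = 5"
  by code_simp
lemma blocks_distinct: "distinct (concat blocks)"
  by code_simp
lemma blocks_card: "\<forall>B \<in> set blocks. card (set B) = 5"
  by code_simp
lemma blocks_neg_swap:
  "\<forall>B \<in> set blocks. \<forall>a \<in> set [1,2,3,4,5]. \<forall>b \<in> set [1,2,3,4,5]. a \<noteq> b \<longrightarrow>
    (\<exists>C \<in> set blocks. set (map (neg_swap a b) B) = set C)"
  by code_simp
lemma blocks_negatives:
  "\<forall>B \<in> set blocks. \<forall>C \<in> set blocks.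
    length (filter (\<lambda>l. map uminus l \<in> set C) B) = (if B = C then 0 else 1)"
  by code_simp
lemma blocks_rot: "\<forall>B \<in> set (tl blocks). set (map rotate1 B) \<noteq> set B"
  by code_simp

definition base_block :: "(nat \<Rightarrow> int) set" where
  "base_block = vector_of ` set pentagon"

definition block_orbit :: "(nat \<Rightarrow> int) set set" where
  "block_orbit = {signed_act \<sigma> ` base_block | \<sigma>. \<sigma> permutes {1..5}}"

definition base_vector :: "nat \<Rightarrow> int" where
  "base_vector = vector_of [0, 1, - 1, - 1, 1]"

lemma signed_act_image_comp:
  assumes "\<sigma> permutes {1..5::nat}" "\<tau> permutes {1..5}"
  shows "signed_act \<sigma> ` signed_act \<tau> ` P = signed_act (\<sigma> \<circ> \<tau>) ` P"
  using assms by (simp add: image_image signed_act_comp)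

lemma base_block_in_orbit: "base_block \<in> block_orbit"
  unfolding block_orbit_def by (auto intro!: exI[of _ id] simp: permutes_id)

lemma signed_act_block_orbit:
  assumes "\<sigma> permutes {1..5::nat}" "P \<in> block_orbit"
  shows "signed_act \<sigma> ` P \<in> block_orbit"
proof -
  obtain \<tau> where "\<tau> permutes {1..5}" "P = signed_act \<tau> ` base_block"
    using assms(2) by (auto simp: block_orbit_def)
  then show ?thesis
    using assms(1) signed_act_image_comp[of \<sigma> \<tau>] permutes_compose[of \<tau> "{1..5}" \<sigma>]
    by (auto simp: block_orbit_def)
qed

text \<open>As transpositions generate the symmetric group, an explicit list closed under transpositions
contains the whole orbit. This reduces the incidence properties of blocks to finite checks on
lists.\<close>
lemma block_orbit_explicit:
  assumes "P \<in> block_orbit"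
  obtains B where "B \<in> set blocks" "P = vector_of ` set B"
proof -
  obtain \<sigma> where \<sigma>: "\<sigma> permutes {1..5::nat}" "P = signed_act \<sigma> ` base_block"
    using assms by (auto simp: block_orbit_def)
  from \<sigma>(1) finite_atLeastAtMost have "\<exists>B \<in> set blocks. signed_act \<sigma> ` base_block = vector_of ` set B"
  proof (induction rule: permutes_induct)
    case id
    show ?case
      by (rule bexI[of _ pentagon]) (simp_all add: base_block_def blocks_def)
  next
    case (swap a b p)
    then obtain B where B: "B \<in> set blocks" "signed_act p ` base_block = vector_of ` set B"
      by blast
    have ab: "a \<in> set [1, 2, 3, 4, 5]" "b \<in> set [1, 2, 3, 4, 5]"
      using swap.hyps by auto
    obtain C where C: "C \<in> set blocks" "set (map (neg_swap a b) B) = set C"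
      using blocks_neg_swap B(1) ab \<open>a \<noteq> b\<close> by blast
    have "signed_act (Transposition.transpose a b \<circ> p) ` base_block =
        signed_act (Transposition.transpose a b) ` vector_of ` set B"
      using swap.hyps by (simp add: signed_act_image_comp permutes_swap_id flip: B(2))
    also have "\<dots> = vector_of ` set (map (neg_swap a b) B)"
      using swap.hyps by (simp add: image_image signed_act_transpose)
    also have "\<dots> = vector_of ` set C"
      by (simp only: C(2))
    finally show ?case
      using C(1) by blast
  qed
  then show thesis
    using that \<sigma>(2) by blast
qed

lemma vector_of_mem_iff:
  assumes "B \<in> set blocks" "length l = 5"
  shows "vector_of l \<in> vector_of ` set B \<longleftrightarrow> l \<in> set B"
  using inj_on_image_mem_iff[OF inj_on_vector_of, of l "set B"] assms blocks_length by auto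

lemma blocks_disjoint:
  assumes "P \<in> block_orbit" "Q \<in> block_orbit" "v \<in> P" "v \<in> Q"
  shows "P = Q"
proof -
  obtain B C where BC: "B \<in> set blocks" "P = vector_of ` set B" "C \<in> set blocks" "Q = vector_of ` set C"
    using assms(1,2) by (metis block_orbit_explicit)
  obtain l where l: "l \<in> set B" "v = vector_of l"
    using assms(3) BC by auto
  have "l \<in> set C"
    using vector_of_mem_iff[OF BC(3), of l] l BC blocks_length assms(4) by auto
  then have "B = C"
    using distinct_concat_iff[of blocks] blocks_distinct BC l by blast
  then show ?thesis using BC by simp
qed

text \<open>The quotient of the cover by translations is thus \<open>K\<^sub>6\<close>: distinct blocks are joined by one arc in
each direction, and no block is joined to itself.\<close>
lemma negatives_in_block:
  assumes "P \<in> block_orbit" "Q \<in> block_orbit"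
  shows "card {v \<in> P. - v \<in> Q} = (if P = Q then 0 else 1)"
proof -
  obtain B C where BC: "B \<in> set blocks" "P = vector_of ` set B" "C \<in> set blocks" "Q = vector_of ` set C"
    using assms(1,2) by (metis block_orbit_explicit)
  let ?F = "filter (\<lambda>l. map uminus l \<in> set C) B"
  have len: "length l = 5" if "l \<in> set B" for l
    using that BC(1) blocks_length by blast
  have "- vector_of l \<in> Q \<longleftrightarrow> map uminus l \<in> set C" if "l \<in> set B" for l
    using vector_of_mem_iff[OF BC(3), of "map uminus l"] len[OF that] by (simp add: BC(4) minus_vector_of)
  then have "{v \<in> P. - v \<in> Q} = vector_of ` set ?F"
    unfolding BC(2) by auto
  moreover have "inj_on vector_of (set ?F)"
    by (rule inj_on_subset[OF inj_on_vector_of]) (use len in auto)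
  moreover have "distinct ?F"
    using blocks_distinct BC(1) by (simp add: distinct_concat_iff)
  ultimately have "card {v \<in> P. - v \<in> Q} = length ?F"
    by (simp only: card_image distinct_card)
  also have "\<dots> = (if B = C then 0 else 1)"
    using blocks_negatives BC(1,3) by blast
  also have "B = C \<longleftrightarrow> P = Q"
  proof
    assume "P = Q"
    have "B \<noteq> []" using blocks_card BC(1) by fastforce
    then obtain l where "l \<in> set B" by (meson last_in_set)
    then have "l \<in> set C"
      using vector_of_mem_iff[OF BC(3), of l] \<open>P = Q\<close> BC len by auto
    then show "B = C"
      using \<open>l \<in> set B\<close> distinct_concat_iff[of blocks] blocks_distinct BC by blast
  qed (simp add: BC)
  finally show ?thesis .
qed

lemma card_block:
  assumes "P \<in> block_orbit"
  shows "card P = 5"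
proof -
  obtain B where B: "B \<in> set blocks" "P = vector_of ` set B"
    using assms by (rule block_orbit_explicit)
  then have "inj_on vector_of (set B)"
    by (intro inj_on_subset[OF inj_on_vector_of]) (use blocks_length in auto)
  then show ?thesis
    using B blocks_card by (simp add: card_image)
qed

lemma rot_fixes_base_block: "signed_act rot ` base_block = base_block"
proof -
  have len: "\<forall>l \<in> set pentagon. length l = 5"
    using blocks_length by (simp add: blocks_def)
  then have "signed_act rot ` base_block = vector_of ` set (map rotate1 pentagon)"
    by (auto simp: base_block_def image_image signed_act_rot)
  also have "set (map rotate1 pentagon) = set pentagon"
    by code_simp
  finally show ?thesis by (simp add: base_block_def)
qed

lemma rot_fixes_only_base_block:
  assumes "P \<in> block_orbit" "signed_act rot ` P = P"
  shows "P = base_block"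
proof -
  obtain B where B: "B \<in> set blocks" "P = vector_of ` set B"
    using assms(1) by (rule block_orbit_explicit)
  have len: "length l = 5" if "l \<in> set B" for l
    using that B(1) blocks_length by blast
  have "vector_of ` set (map rotate1 B) = signed_act rot ` P"
    using len by (auto simp: B(2) image_image signed_act_rot)
  then have "vector_of ` set (map rotate1 B) = vector_of ` set B"
    using assms(2) B(2) by simp
  then have "set (map rotate1 B) = set B"
    by (rule inj_on_image_eq_iff[OF inj_on_vector_of, THEN iffD1, rotated 2]) (use len in auto)
  then have "B \<notin> set (tl blocks)"
    using blocks_rot by blast
  then have "B = pentagon"
    using B(1) by (simp add: blocks_def)
  then show ?thesis
    using B(2) by (simp add: base_block_def)
qed

lemma base_vector_in_base_block: "base_vector \<in> base_block"
  unfolding base_vector_def base_block_def pentagon_def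
  by (rule imageI) (simp add: upt_rec)

lemma base_block_eq_rotations:
  assumes "v \<in> base_block"
  obtains \<sigma> where "\<sigma> permutes {1..5}" "signed_act \<sigma> ` base_block = base_block" "signed_act \<sigma> base_vector = v"
proof -
  obtain k where k: "v = vector_of (rotate k [0, 1, - 1, - 1, 1])"
    using assms by (auto simp: base_block_def pentagon_def)
  have "rot ^^ k permutes {1..5} \<and> signed_act (rot ^^ k) ` base_block = base_block \<and>
    signed_act (rot ^^ k) base_vector = vector_of (rotate k [0, 1, - 1, - 1, 1])"
  proof (induction k)
    case 0
    show ?case by (simp add: permutes_id[unfolded id_def] base_vector_def)
  next
    case (Suc k)
    then have *: "rot \<circ> rot ^^ k permutes {1..5}"
      by (intro permutes_compose rot_permutes) simp
    have "signed_act (rot \<circ> rot ^^ k) ` base_block = base_block"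
      using Suc rot_fixes_base_block signed_act_image_comp[OF rot_permutes, of "rot ^^ k" base_block] by simp
    moreover have "signed_act (rot \<circ> rot ^^ k) base_vector = vector_of (rotate (Suc k) [0, 1, - 1, - 1, 1])"
      using Suc signed_act_comp[OF rot_permutes, of "rot ^^ k" base_vector] by (simp add: signed_act_rot)
    ultimately show ?case using * unfolding funpow.simps by blast
  qed
  then show thesis using that k by blast
qed

text \<open>The orbit of the base block is transitive by construction, and the rotations, which preserve the
base block, are transitive on its vectors.\<close>
lemma flag_transitive:
  assumes "P \<in> block_orbit" "v \<in> P"
  obtains \<sigma> where "\<sigma> permutes {1..5}" "signed_act \<sigma> ` base_block = P" "signed_act \<sigma> base_vector = v"
proof -
  obtain \<tau> where \<tau>: "\<tau> permutes {1..5}" "P = signed_act \<tau> ` base_block"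
    using assms(1) by (auto simp: block_orbit_def)
  then obtain u where u: "u \<in> base_block" "v = signed_act \<tau> u"
    using assms(2) by auto
  obtain \<rho> where \<rho>: "\<rho> permutes {1..5}" "signed_act \<rho> ` base_block = base_block" "signed_act \<rho> base_vector = u"
    using u(1) by (rule base_block_eq_rotations)
  show thesis
  proof (rule that[of "\<tau> \<circ> \<rho>"])
    show "\<tau> \<circ> \<rho> permutes {1..5}"
      using \<tau>(1) \<rho>(1) by (simp add: permutes_compose)
    show "signed_act (\<tau> \<circ> \<rho>) ` base_block = P"
      using \<tau> \<rho> signed_act_image_comp[of \<tau> \<rho> base_block] by simp
    show "signed_act (\<tau> \<circ> \<rho>) base_vector = v"
      using \<tau> \<rho> u by (simp add: signed_act_comp)
  qed
qed

lemma base_vector_in_zero_sum: "base_vector \<in> zero_sum"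
  unfolding base_vector_def zero_sum_def vector_of_def coordinates_eq by auto

lemma block_in_zero_sum:
  assumes "P \<in> block_orbit" "v \<in> P"
  shows "v \<in> zero_sum"
  using flag_transitive[OF assms] base_vector_in_zero_sum zero_sum_signed_act by metis

text \<open>The transposition of the coordinates 2 and 5, in which (0,1,-1,-1,1) has equal entries, maps this
vector to its negative; the general case follows by transitivity.\<close>
lemma neg_in_some_block:
  assumes "P \<in> block_orbit" "v \<in> P"
  obtains Q where "Q \<in> block_orbit" "- v \<in> Q"
proof -
  obtain \<sigma> where \<sigma>: "\<sigma> permutes {1..5}" "signed_act \<sigma> base_vector = v"
    using assms by (rule flag_transitive)
  let ?\<tau> = "Transposition.transpose 2 (5::nat)"
  have "neg_swap 2 5 [0, 1, - 1, - 1, 1] = map uminus [0, 1, - 1, - 1, 1]"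
    by code_simp
  then have neg: "signed_act ?\<tau> base_vector = - base_vector"
    by (simp add: base_vector_def signed_act_transpose minus_vector_of)
  have "?\<tau> permutes {1..5}"
    by (rule permutes_swap_id) auto
  then have "signed_act \<sigma> ` signed_act ?\<tau> ` base_block \<in> block_orbit"
    by (intro signed_act_block_orbit base_block_in_orbit \<sigma>)
  moreover have "- v \<in> signed_act \<sigma> ` signed_act ?\<tau> ` base_block"
    using base_vector_in_base_block \<sigma>(2)
    by (auto simp: image_iff neg signed_act_minus intro!: bexI[of _ base_vector])
  ultimately show thesis by (rule that)
qed

lemma unique_neighbour_block:
  assumes "P \<in> block_orbit" "v \<in> P"
  shows "\<exists>!Q. Q \<in> block_orbit \<and> - v \<in> Q"
  using neg_in_some_block[OF assms] blocks_disjoint by metis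

section \<open>Relabelling the vertices of a graph\<close>
definition relabel :: "('a \<Rightarrow> 'b) \<Rightarrow> 'a set \<Rightarrow> 'a rel \<Rightarrow> 'b pair_pre_digraph" where
  "relabel c V E = \<lparr>pverts = c ` V, parcs = map_prod c c ` E\<rparr>"

definition relabel_map :: "('a \<Rightarrow> 'b) \<Rightarrow> 'a set \<Rightarrow> ('a \<Rightarrow> 'a) \<Rightarrow> 'b \<Rightarrow> 'b" where
  "relabel_map c V \<phi> = (\<lambda>y \<in> c ` V. c (\<phi> (inv_into V c y)))"

lemma pverts_relabel [simp]: "pverts (relabel c V E) = c ` V"
  by (simp add: relabel_def)

lemma relabel_arc_iff:
  assumes "inj_on c V" "E \<subseteq> V \<times> V" "u \<in> V" "v \<in> V"
  shows "(c u, c v) \<in> parcs (relabel c V E) \<longleftrightarrow> (u, v) \<in> E"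
proof -
  have "(u, v) \<in> E" if "(u', v') \<in> E" "c u = c u'" "c v = c v'" for u' v'
    using that assms by (metis inj_onD mem_Sigma_iff subsetD)
  then show ?thesis
    by (force simp: relabel_def)
qed

lemma relabel_map_apply [simp]:
  "inj_on c V \<Longrightarrow> v \<in> V \<Longrightarrow> relabel_map c V \<phi> (c v) = c (\<phi> v)"
  by (simp add: relabel_map_def)

lemma relabel_map_compose:
  assumes "inj_on c V" "\<psi> \<in> V \<rightarrow> V"
  shows "compose (c ` V) (relabel_map c V \<phi>) (relabel_map c V \<psi>) = relabel_map c V (\<phi> \<circ> \<psi>)"
proof
  fix y
  show "compose (c ` V) (relabel_map c V \<phi>) (relabel_map c V \<psi>) y = relabel_map c V (\<phi> \<circ> \<psi>) y"
  proof (cases "y \<in> c ` V")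
    case True
    then obtain v where "v \<in> V" "y = c v" by blast
    moreover from this have "\<psi> v \<in> V" using assms(2) by blast
    ultimately show ?thesis using assms(1) by (simp add: compose_def)
  next
    case False
    then show ?thesis by (simp add: compose_def relabel_map_def)
  qed
qed

lemma relabel_map_funpow:
  assumes "inj_on c V" "\<And>v. v \<in> V \<Longrightarrow> \<phi> v \<in> V" "v \<in> V"
  shows "(relabel_map c V \<phi> ^^ k) (c v) = c ((\<phi> ^^ k) v)"
proof -
  have "(\<phi> ^^ k) v \<in> V \<and> (relabel_map c V \<phi> ^^ k) (c v) = c ((\<phi> ^^ k) v)"
    by (induction k) (simp_all add: assms)
  then show ?thesis ..
qed

lemma carrier_graph_aut_group: "carrier (graph_aut_group G) = graph_automorphisms G"
  by (simp add: graph_aut_group_def)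

lemma relabel_map_automorphism:
  assumes c: "inj_on c V" and E: "E \<subseteq> V \<times> V"
    and maps: "\<And>v. v \<in> V \<Longrightarrow> \<phi> v \<in> V" "\<And>v. v \<in> V \<Longrightarrow> \<psi> v \<in> V"
    and inverse: "\<And>v. v \<in> V \<Longrightarrow> \<psi> (\<phi> v) = v" "\<And>v. v \<in> V \<Longrightarrow> \<phi> (\<psi> v) = v"
    and arcs: "\<And>u v. (u, v) \<in> E \<Longrightarrow> (\<phi> u, \<phi> v) \<in> E" "\<And>u v. (u, v) \<in> E \<Longrightarrow> (\<psi> u, \<psi> v) \<in> E"
  shows "relabel_map c V \<phi> \<in> carrier (graph_aut_group (relabel c V E))"
proof -
  have "bij_betw (relabel_map c V \<phi>) (c ` V) (c ` V)"
    by (rule bij_betwI[where g = "relabel_map c V \<psi>"]) (use c maps inverse in auto)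
  moreover have "relabel_map c V \<phi> \<in> extensional (c ` V)"
    by (simp add: relabel_map_def)
  moreover have "(\<phi> u, \<phi> v) \<in> E \<longleftrightarrow> (u, v) \<in> E" if "u \<in> V" "v \<in> V" for u v
    using arcs inverse(1) that by metis
  ultimately show ?thesis
    using c E maps by (simp add: carrier_graph_aut_group graph_automorphisms_def Bij_def relabel_arc_iff)
qed

lemma relabel_connected:
  assumes "V \<noteq> {}" "E \<subseteq> V \<times> V" "\<And>u v. u \<in> V \<Longrightarrow> v \<in> V \<Longrightarrow> (u, v) \<in> E\<^sup>*"
  shows "Digraph_Component.connected (with_proj (relabel c V E))"
proof -
  let ?G = "relabel c V E"
  have wf: "wf_digraph (with_proj ?G)"
    using assms(2) by unfold_locales (auto simp: relabel_def)
  have "c u \<rightarrow>\<^sup>*\<^bsub>with_proj ?G\<^esub> c v" if "(u, v) \<in> E\<^sup>*" "u \<in> V" for u v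
    using that
  proof (induction rule: rtrancl_induct)
    case base
    then show ?case
      using wf by (simp add: wf_digraph.reachable_refl)
  next
    case (step v w)
    then have "c v \<rightarrow>\<^bsub>with_proj ?G\<^esub> c w"
      by (force simp: relabel_def)
    then show ?case
      using step wf wf_digraph.reachable_adj_trans by fast
  qed
  then have "u \<rightarrow>\<^sup>*\<^bsub>with_proj ?G\<^esub> v" if "u \<in> c ` V" "v \<in> c ` V" for u v
    using that assms(3) by blast
  then have "strongly_connected (with_proj (mk_symmetric (with_proj ?G)))"
    using assms(1) wf by (intro strongly_connectedI) (auto intro: wf_digraph.reachable_mk_symmetricI)
  then show ?thesis
    by (simp add: connected_def)
qed

lemma relabel_pair_graph:
  assumes "finite V" "E \<subseteq> V \<times> V" "inj_on c V" "sym E" "irrefl E"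
  shows "pair_graph (relabel c V E)"
proof -
  have "finite E"
    using assms(1,2) finite_subset by blast
  moreover have "sym (map_prod c c ` E)"
    using assms(4) by (auto simp: sym_def)
  moreover have "c u \<noteq> c v" if "(u, v) \<in> E" for u v
    using that assms(2,3,5) by (auto dest!: inj_onD simp: irrefl_def)
  ultimately show ?thesis
    using assms(1,2)
    by unfold_locales (auto simp: relabel_def symmetric_def)
qed

lemma relabel_out_degree:
  assumes "inj_on c V" "E \<subseteq> V \<times> V" "u \<in> V"
  shows "out_degree (with_proj (relabel c V E)) (c u) = card {v. (u, v) \<in> E}"
proof -
  have "out_arcs (with_proj (relabel c V E)) (c u) = (\<lambda>v. (c u, c v)) ` {v. (u, v) \<in> E}"
    using assms by (force simp: out_arcs_def relabel_def dest: inj_onD)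
  moreover have "inj_on (\<lambda>v. (c u, c v)) {v. (u, v) \<in> E}"
    using assms by (auto intro!: inj_onI dest: inj_onD)
  ultimately show ?thesis
    by (simp add: out_degree_def card_image)
qed

section \<open>Covers of the complete graph on six vertices\<close>
definition reduce :: "int \<Rightarrow> (nat \<Rightarrow> int) \<Rightarrow> nat \<Rightarrow> int" where
  "reduce n x = (\<lambda>i. x i mod n)"

lemma reduce_add_left: "reduce n (reduce n x + y) = reduce n (x + y)"
  by (simp add: reduce_def fun_eq_iff mod_simps)

lemma reduce_signed_act: "reduce n (signed_act \<sigma> (reduce n x)) = reduce n (signed_act \<sigma> x)"
  by (simp add: reduce_def signed_act_def fun_eq_iff mod_simps)

lemma reduce_signed_act_add: "reduce n (signed_act \<sigma> (reduce n x) + y) = reduce n (signed_act \<sigma> x + y)"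
  by (metis reduce_signed_act reduce_add_left)

text \<open>The blocks stay integral; only the second component is reduced modulo \<open>n\<close>. A vertex is thus
written \<open>(P, reduce n x)\<close> with an integral zero-sum vector \<open>x\<close>, and identities between vertices
become identities between integral vectors.\<close>
definition cover_vertices :: "int \<Rightarrow> ((nat \<Rightarrow> int) set \<times> (nat \<Rightarrow> int)) set" where
  "cover_vertices n = block_orbit \<times> reduce n ` zero_sum"

definition cover_arcs :: "int \<Rightarrow> ((nat \<Rightarrow> int) set \<times> (nat \<Rightarrow> int)) rel" where
  "cover_arcs n = {((P, reduce n x), (Q, reduce n (x + v))) | P Q x v.
    P \<in> block_orbit \<and> Q \<in> block_orbit \<and> x \<in> zero_sum \<and> v \<in> P \<and> - v \<in> Q}"

definition affine :: "int \<Rightarrow> (nat \<Rightarrow> nat) \<Rightarrow> (nat \<Rightarrow> int) \<Rightarrow>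
    (nat \<Rightarrow> int) set \<times> (nat \<Rightarrow> int) \<Rightarrow> (nat \<Rightarrow> int) set \<times> (nat \<Rightarrow> int)" where
  "affine n \<sigma> w = (\<lambda>(P, x). (signed_act \<sigma> ` P, reduce n (signed_act \<sigma> x + w)))"

lemma cover_verticesE:
  assumes "p \<in> cover_vertices n"
  obtains P x where "p = (P, reduce n x)" "P \<in> block_orbit" "x \<in> zero_sum"
  using assms by (auto simp: cover_vertices_def)

lemma cover_arcs_subset: "cover_arcs n \<subseteq> cover_vertices n \<times> cover_vertices n"
  by (auto simp: cover_arcs_def cover_vertices_def intro: zero_sum_add block_in_zero_sum)

lemma cover_arcsI:
  assumes "P \<in> block_orbit" "Q \<in> block_orbit" "x \<in> zero_sum" "v \<in> P" "- v \<in> Q"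
  shows "((P, reduce n x), (Q, reduce n (x + v))) \<in> cover_arcs n"
  using assms unfolding cover_arcs_def by blast

lemma cover_arcsE:
  assumes "e \<in> cover_arcs n"
  obtains P Q x v where "P \<in> block_orbit" "Q \<in> block_orbit" "x \<in> zero_sum" "v \<in> P" "- v \<in> Q"
    "e = ((P, reduce n x), (Q, reduce n (x + v)))"
  using assms unfolding cover_arcs_def by blast

lemma sym_cover_arcs: "sym (cover_arcs n)"
proof (rule symI)
  fix p q assume "(p, q) \<in> cover_arcs n"
  then obtain P Q x v where *: "P \<in> block_orbit" "Q \<in> block_orbit" "x \<in> zero_sum" "v \<in> P" "- v \<in> Q"
    "p = (P, reduce n x)" "q = (Q, reduce n (x + v))"
    by (auto elim: cover_arcsE)
  then have "((Q, reduce n (x + v)), (P, reduce n (x + v + - v))) \<in> cover_arcs n"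
    by (intro cover_arcsI zero_sum_add) (auto intro: block_in_zero_sum)
  then show "(q, p) \<in> cover_arcs n"
    using * by simp
qed

lemma neg_notin_block:
  assumes "P \<in> block_orbit" "v \<in> P"
  shows "- v \<notin> P"
proof -
  have "finite P" using card_block[OF assms(1)] card.infinite by fastforce
  then have "{v \<in> P. - v \<in> P} = {}"
    using negatives_in_block[OF assms(1,1)] by (metis (no_types, lifting) card_0_eq finite_Collect_conjI finite_subset mem_Collect_eq subsetI)
  then show ?thesis using assms(2) by blast
qed

lemma irrefl_cover_arcs: "irrefl (cover_arcs n)"
  by (rule irreflI) (auto elim!: cover_arcsE dest: neg_notin_block)

lemma finite_cover_vertices:
  assumes "n > 0"
  shows "finite (cover_vertices n)"
proof -
  have "block_orbit \<subseteq> (\<lambda>B. vector_of ` set B) ` set blocks"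
    by (auto elim: block_orbit_explicit)
  then have "finite block_orbit"
    using finite_surj by blast
  moreover have "reduce n ` zero_sum \<subseteq>
      {f. \<forall>i. (i \<in> {1..5} \<longrightarrow> f i \<in> {0..<n}) \<and> (i \<notin> {1..5} \<longrightarrow> f i = 0)}"
    using assms by (auto simp: reduce_def zero_sum_def)
  then have "finite (reduce n ` zero_sum)"
    by (rule finite_subset) (rule finite_set_of_finite_funs, auto)
  ultimately show ?thesis
    by (simp add: cover_vertices_def)
qed

lemma affine_reduce: "affine n \<sigma> w (P, reduce n x) = (signed_act \<sigma> ` P, reduce n (signed_act \<sigma> x + w))"
  by (simp add: affine_def reduce_signed_act_add)

lemma affine_cover_vertices:
  assumes "\<sigma> permutes {1..5}" "w \<in> zero_sum" "p \<in> cover_vertices n"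
  shows "affine n \<sigma> w p \<in> cover_vertices n"
  using assms(3)
proof (rule cover_verticesE)
  fix P x assume "p = (P, reduce n x)" "P \<in> block_orbit" "x \<in> zero_sum"
  then show ?thesis
    using assms by (simp add: affine_reduce cover_vertices_def signed_act_block_orbit zero_sum_add zero_sum_signed_act)
qed

lemma affine_cover_arcs:
  assumes "\<sigma> permutes {1..5}" "w \<in> zero_sum" "(p, q) \<in> cover_arcs n"
  shows "(affine n \<sigma> w p, affine n \<sigma> w q) \<in> cover_arcs n"
  using assms(3)
proof (rule cover_arcsE)
  fix P Q x v
  assume *: "P \<in> block_orbit" "Q \<in> block_orbit" "x \<in> zero_sum" "v \<in> P" "- v \<in> Q"
    "(p, q) = ((P, reduce n x), (Q, reduce n (x + v)))"
  have "- signed_act \<sigma> v \<in> signed_act \<sigma> ` Q"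
    using *(5) by (metis signed_act_minus imageI)
  then have "((signed_act \<sigma> ` P, reduce n (signed_act \<sigma> x + w)),
      (signed_act \<sigma> ` Q, reduce n (signed_act \<sigma> x + w + signed_act \<sigma> v))) \<in> cover_arcs n"
    using * assms by (intro cover_arcsI signed_act_block_orbit zero_sum_add zero_sum_signed_act imageI)
  then show ?thesis
    using * by (simp add: affine_reduce signed_act_add add_ac)
qed

lemma affine_comp:
  assumes "\<sigma> permutes {1..5}" "\<tau> permutes {1..5}"
  shows "affine n \<sigma> w (affine n \<tau> u p) = affine n (\<sigma> \<circ> \<tau>) (signed_act \<sigma> u + w) p"
  using assms
  by (cases p) (simp add: affine_def reduce_signed_act_add signed_act_image_comp signed_act_comp signed_act_add add.assoc)

lemma affine_id:
  assumes "p \<in> cover_vertices n"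
  shows "affine n id 0 p = p"
  using assms by (rule cover_verticesE) (simp add: affine_reduce)

text \<open>Affine maps form a group, so that each of them, being arc-preserving together with its inverse, is
an automorphism.\<close>
lemma affine_inverse:
  assumes "\<sigma> permutes {1..5}" "w \<in> zero_sum" "p \<in> cover_vertices n"
  shows "affine n (inv' \<sigma>) (- signed_act (inv' \<sigma>) w) (affine n \<sigma> w p) = p"
    and "affine n \<sigma> w (affine n (inv' \<sigma>) (- signed_act (inv' \<sigma>) w) p) = p"
  using assms affine_id[OF assms(3)]
  by (simp_all add: affine_comp permutes_inv permutes_inv_o signed_act_minus signed_act_inv)

section \<open>Valency and arc-transitivity\<close>
text \<open>The neighbours of \<open>(P, x)\<close> correspond to the vectors \<open>v \<in> P\<close>: the block containing \<open>-v\<close> is unique,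
and different vectors of \<open>P\<close> lead to different blocks.\<close>
lemma card_out_neighbours:
  assumes "p \<in> cover_vertices n"
  shows "card {q. (p, q) \<in> cover_arcs n} = 5"
  using assms
proof (rule cover_verticesE)
  fix P x assume p: "p = (P, reduce n x)" and P: "P \<in> block_orbit" and x: "x \<in> zero_sum"
  define opp where "opp v = (THE Q. Q \<in> block_orbit \<and> - v \<in> Q)" for v
  have opp: "opp v \<in> block_orbit" "- v \<in> opp v" if "v \<in> P" for v
    using theI'[OF unique_neighbour_block[OF P that]] by (auto simp: opp_def)
  have opp_eq: "opp v = Q" if "v \<in> P" "Q \<in> block_orbit" "- v \<in> Q" for v Q
    using blocks_disjoint opp that by blast
  have "{q. (p, q) \<in> cover_arcs n} = (\<lambda>v. (opp v, reduce n (x + v))) ` P"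
  proof (intro equalityI subsetI)
    fix q assume "q \<in> {q. (p, q) \<in> cover_arcs n}"
    then obtain Q y v where *: "Q \<in> block_orbit" "v \<in> P" "- v \<in> Q" "reduce n x = reduce n y"
        "q = (Q, reduce n (y + v))"
      unfolding p by (auto elim!: cover_arcsE)
    then have "q = (opp v, reduce n (x + v))"
      by (metis opp_eq reduce_add_left)
    then show "q \<in> (\<lambda>v. (opp v, reduce n (x + v))) ` P"
      using *(2) by blast
  next
    fix q assume "q \<in> (\<lambda>v. (opp v, reduce n (x + v))) ` P"
    then show "q \<in> {q. (p, q) \<in> cover_arcs n}"
      unfolding p using P x opp by (auto intro: cover_arcsI)
  qed
  moreover have "inj_on (\<lambda>v. (opp v, reduce n (x + v))) P"
  proof (rule inj_onI)
    fix u v assume uv: "u \<in> P" "v \<in> P" "(opp u, reduce n (x + u)) = (opp v, reduce n (x + v))"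
    let ?S = "{w \<in> P. - w \<in> opp u}"
    have "card ?S \<le> 1"
      using negatives_in_block[OF P opp(1)[OF uv(1)]] by simp
    moreover have "finite ?S"
      using card_block[OF P] by (simp add: card_ge_0_finite)
    ultimately show "u = v"
      using uv opp(2)[OF uv(1)] opp(2)[OF uv(2)] card_le_Suc0_iff_eq[of ?S] by auto
  qed
  ultimately show ?thesis
    using card_block[OF P] by (simp add: card_image)
qed

lemma arc_from_base:
  assumes "(p, q) \<in> cover_arcs n" "Q\<^sub>0 \<in> block_orbit" "- base_vector \<in> Q\<^sub>0"
  obtains \<sigma> w where "\<sigma> permutes {1..5}" "w \<in> zero_sum"
    "affine n \<sigma> w (base_block, reduce n 0) = p" "affine n \<sigma> w (Q\<^sub>0, reduce n base_vector) = q"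
  using assms(1)
proof (rule cover_arcsE)
  fix P Q x v
  assume *: "P \<in> block_orbit" "Q \<in> block_orbit" "x \<in> zero_sum" "v \<in> P" "- v \<in> Q"
    "(p, q) = ((P, reduce n x), (Q, reduce n (x + v)))"
  obtain \<sigma> where \<sigma>: "\<sigma> permutes {1..5}" "signed_act \<sigma> ` base_block = P" "signed_act \<sigma> base_vector = v"
    using *(1,4) by (rule flag_transitive)
  have "- v \<in> signed_act \<sigma> ` Q\<^sub>0"
    using assms(3) \<sigma>(3) by (metis signed_act_minus imageI)
  then have "signed_act \<sigma> ` Q\<^sub>0 = Q"
    using blocks_disjoint[OF signed_act_block_orbit[OF \<sigma>(1) assms(2)] *(2)] *(5) by blast
  then show thesis
    using that[OF \<sigma>(1) *(3)] * \<sigma> by (simp add: affine_reduce add.commute)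
qed

text \<open>It suffices to reach every arc from one arc at \<open>(base_block, 0)\<close>: a signed permutation moves the base
flag to the required flag, and a translation then moves the second component. The block at the far
end follows, because it is determined by the negated vector.\<close>
lemma affine_arc_transitive:
  assumes "(p, q) \<in> cover_arcs n" "(p', q') \<in> cover_arcs n"
  obtains \<sigma> w where "\<sigma> permutes {1..5}" "w \<in> zero_sum" "affine n \<sigma> w p = p'" "affine n \<sigma> w q = q'"
proof -
  obtain Q\<^sub>0 where Q\<^sub>0: "Q\<^sub>0 \<in> block_orbit" "- base_vector \<in> Q\<^sub>0"
    using neg_in_some_block base_block_in_orbit base_vector_in_base_block by blast
  define b where "b = (base_block, reduce n 0)"
  define c where "c = (Q\<^sub>0, reduce n base_vector)"
  have bc: "b \<in> cover_vertices n" "c \<in> cover_vertices n"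
    using Q\<^sub>0 by (simp_all add: b_def c_def cover_vertices_def base_block_in_orbit zero_sum_zero base_vector_in_zero_sum)
  obtain \<sigma> w where \<sigma>: "\<sigma> permutes {1..5}" "w \<in> zero_sum" "affine n \<sigma> w b = p" "affine n \<sigma> w c = q"
    using arc_from_base[OF assms(1) Q\<^sub>0] unfolding b_def c_def by blast
  obtain \<tau> u where \<tau>: "\<tau> permutes {1..5}" "u \<in> zero_sum" "affine n \<tau> u b = p'" "affine n \<tau> u c = q'"
    using arc_from_base[OF assms(2) Q\<^sub>0] unfolding b_def c_def by blast
  have inv: "inv' \<sigma> permutes {1..5}"
    using \<sigma>(1) by (rule permutes_inv)
  let ?w = "- signed_act (inv' \<sigma>) w"
  have to_base: "affine n (inv' \<sigma>) ?w p = b" "affine n (inv' \<sigma>) ?w q = c"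
    using affine_inverse(1)[OF \<sigma>(1,2) bc(1)] affine_inverse(1)[OF \<sigma>(1,2) bc(2)] \<sigma>(3,4) by simp_all
  show thesis
  proof (rule that)
    show "\<tau> \<circ> inv' \<sigma> permutes {1..5}"
      using inv \<tau>(1) by (rule permutes_compose)
    show "signed_act \<tau> ?w + u \<in> zero_sum"
      using \<sigma> \<tau> inv by (intro zero_sum_add zero_sum_signed_act zero_sum_minus)
    show "affine n (\<tau> \<circ> inv' \<sigma>) (signed_act \<tau> ?w + u) p = p'" "affine n (\<tau> \<circ> inv' \<sigma>) (signed_act \<tau> ?w + u) q = q'"
      using to_base \<tau> affine_comp[OF \<tau>(1) inv, of n u ?w] by metis+
  qed
qed

section \<open>Connectedness\<close>
lemma affine_path:
  assumes "(p, q) \<in> (cover_arcs n)\<^sup>*" "\<sigma> permutes {1..5}" "w \<in> zero_sum"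
  shows "(affine n \<sigma> w p, affine n \<sigma> w q) \<in> (cover_arcs n)\<^sup>*"
  using assms(1) by induction (auto intro: rtrancl_into_rtrancl affine_cover_arcs[OF assms(2,3)])

lemma translate_path:
  assumes "((P, reduce n x), (Q, reduce n y)) \<in> (cover_arcs n)\<^sup>*" "w \<in> zero_sum"
  shows "((P, reduce n (x + w)), (Q, reduce n (y + w))) \<in> (cover_arcs n)\<^sup>*"
  using affine_path[OF assms(1) permutes_id assms(2)] by (simp add: affine_reduce)

text \<open>The complete graph has every block adjacent to the base block, so one arc suffices.\<close>
lemma path_to_block:
  assumes "Q \<in> block_orbit"
  obtains u where "u \<in> zero_sum" "((base_block, reduce n 0), (Q, reduce n u)) \<in> (cover_arcs n)\<^sup>*"
proof (cases "Q = base_block")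
  case True
  then show thesis using that[of 0] zero_sum_zero by simp
next
  case False
  then have "card {v \<in> base_block. - v \<in> Q} = 1"
    using negatives_in_block[OF base_block_in_orbit assms] by simp
  then obtain v where v: "v \<in> base_block" "- v \<in> Q"
    by (metis (mono_tags, lifting) card_1_singletonE mem_Collect_eq singletonI)
  then have "((base_block, reduce n 0), (Q, reduce n (0 + v))) \<in> cover_arcs n"
    using assms by (intro cover_arcsI base_block_in_orbit zero_sum_zero)
  then show thesis
    using that[of v] v block_in_zero_sum[OF base_block_in_orbit] by auto
qed

text \<open>The vectors \<open>w\<close> for which translation by \<open>w\<close> preserves the connected component of
\<open>(base_block, 0)\<close>.\<close>
definition closed_walk_voltages :: "int \<Rightarrow> (nat \<Rightarrow> int) set" where
  "closed_walk_voltages n =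
    {w \<in> zero_sum. ((base_block, reduce n 0), (base_block, reduce n w)) \<in> (cover_arcs n)\<^sup>*}"

lemma closed_walk_voltages_add:
  assumes "w \<in> closed_walk_voltages n" "w' \<in> closed_walk_voltages n"
  shows "w + w' \<in> closed_walk_voltages n"
proof -
  have "((base_block, reduce n w'), (base_block, reduce n (w + w'))) \<in> (cover_arcs n)\<^sup>*"
    using assms translate_path[of base_block n 0 base_block w w']
    by (auto simp: closed_walk_voltages_def)
  then show ?thesis
    using assms by (auto simp: closed_walk_voltages_def zero_sum_add)
qed

text \<open>A signed permutation carries closed walks at the base block to closed walks at another block \<open>Q\<close>.
Going first from the base block to \<open>Q\<close> and finally back along the same path, translated, leaves the
total voltage unchanged because the covering group is abelian.\<close>
lemma closed_walk_voltages_signed_act: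
  assumes "\<sigma> permutes {1..5}" "w \<in> closed_walk_voltages n"
  shows "signed_act \<sigma> w \<in> closed_walk_voltages n"
proof -
  let ?Q = "signed_act \<sigma> ` base_block"
  have w: "w \<in> zero_sum" and aw: "signed_act \<sigma> w \<in> zero_sum"
    using assms by (auto simp: closed_walk_voltages_def zero_sum_signed_act)
  obtain u where u: "u \<in> zero_sum" "((base_block, reduce n 0), (?Q, reduce n u)) \<in> (cover_arcs n)\<^sup>*"
    using path_to_block[OF signed_act_block_orbit[OF assms(1) base_block_in_orbit]] by blast
  have "((?Q, reduce n 0), (?Q, reduce n (signed_act \<sigma> w))) \<in> (cover_arcs n)\<^sup>*"
    using affine_path[of "(base_block, reduce n 0)" "(base_block, reduce n w)" n \<sigma> 0] assms
    by (simp add: closed_walk_voltages_def affine_reduce zero_sum_zero)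
  from translate_path[OF this u(1)]
  have "((?Q, reduce n u), (?Q, reduce n (u + signed_act \<sigma> w))) \<in> (cover_arcs n)\<^sup>*"
    by (simp add: add.commute)
  moreover have "((?Q, reduce n (u + signed_act \<sigma> w)), (base_block, reduce n (signed_act \<sigma> w))) \<in> (cover_arcs n)\<^sup>*"
    using translate_path[OF u(2) aw] sym_rtrancl[OF sym_cover_arcs] by (auto dest: symD)
  ultimately show ?thesis
    using u(2) aw by (auto simp: closed_walk_voltages_def)
qed

definition unit_diff :: "nat \<Rightarrow> nat \<Rightarrow> nat \<Rightarrow> int" where
  "unit_diff i j = (\<lambda>k. (if k = i then 1 else 0) - (if k = j then 1 else 0))"

definition scale :: "int \<Rightarrow> (nat \<Rightarrow> int) \<Rightarrow> nat \<Rightarrow> int" where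
  "scale k x = (\<lambda>i. k * x i)"

lemma scale_in_zero_sum: "x \<in> zero_sum \<Longrightarrow> scale k x \<in> zero_sum"
  by (auto simp: scale_def zero_sum_def simp flip: sum_distrib_left)

lemma closed_walk_voltages_minus:
  assumes "w \<in> closed_walk_voltages n"
  shows "- w \<in> closed_walk_voltages n"
proof -
  have w: "w \<in> zero_sum" "((base_block, reduce n w), (base_block, reduce n 0)) \<in> (cover_arcs n)\<^sup>*"
    using assms sym_rtrancl[OF sym_cover_arcs] by (auto simp: closed_walk_voltages_def dest: symD)
  then show ?thesis
    using translate_path[OF w(2) zero_sum_minus[OF w(1)]]
    by (simp add: closed_walk_voltages_def zero_sum_minus)
qed

lemma closed_walk_voltages_scale:
  assumes "w \<in> closed_walk_voltages n"
  shows "scale k w \<in> closed_walk_voltages n"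
proof -
  have nonneg: "scale (int m) w \<in> closed_walk_voltages n" for m
  proof (induction m)
    case 0
    have "scale (int 0) w = 0" by (simp add: scale_def fun_eq_iff)
    moreover have "0 \<in> closed_walk_voltages n"
      by (simp add: closed_walk_voltages_def zero_sum_zero)
    ultimately show ?case by metis
  next
    case (Suc m)
    have "scale (int (Suc m)) w = w + scale (int m) w"
      by (simp add: scale_def fun_eq_iff algebra_simps)
    moreover have "w + scale (int m) w \<in> closed_walk_voltages n"
      using assms Suc by (rule closed_walk_voltages_add)
    ultimately show ?case by metis
  qed
  show ?thesis
  proof (cases "k \<ge> 0")
    case True
    then show ?thesis using nonneg[of "nat k"] by simp
  next
    case False
    then have "scale k w = - scale (int (nat (- k))) w"
      by (simp add: scale_def fun_eq_iff)
    then show ?thesis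
      using closed_walk_voltages_minus[OF nonneg[of "nat (- k)"]] by simp
  qed
qed

text \<open>The three corners are the base block and its images under two transpositions; the voltage is
(0,1,-1,-1,1) + (1,1,0,-1,-1) + (-1,1,1,-1,0) = (0,3,0,-3,0).\<close>
lemma triangle_voltage: "scale 3 (unit_diff 2 4) \<in> closed_walk_voltages n"
proof -
  define u\<^sub>1 u\<^sub>2 u\<^sub>3 where "u\<^sub>1 = vector_of [0, 1, - 1, - 1, 1]"
    and "u\<^sub>2 = vector_of [1, 1, 0, - 1, - 1]" and "u\<^sub>3 = vector_of [- 1, 1, 1, - 1, 0]"
  define Q R where "Q = signed_act (Transposition.transpose 2 5) ` base_block"
    and "R = signed_act (Transposition.transpose 1 4) ` base_block"
  have QR: "Q \<in> block_orbit" "R \<in> block_orbit"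
    unfolding Q_def R_def by (auto intro!: signed_act_block_orbit base_block_in_orbit permutes_swap_id)
  have mem: "vector_of l \<in> signed_act (Transposition.transpose a b) ` base_block"
    if "a \<in> {1..5}" "b \<in> {1..5}" "a \<noteq> b" "k \<in> set pentagon" "neg_swap a b k = l" for a b k l
    using that signed_act_transpose[of a b k] unfolding base_block_def by (metis imageI)
  have u: "u\<^sub>1 \<in> base_block" "- u\<^sub>1 \<in> Q" "u\<^sub>2 \<in> Q" "- u\<^sub>2 \<in> R" "u\<^sub>3 \<in> R" "- u\<^sub>3 \<in> base_block"
  proof -
    show "u\<^sub>1 \<in> base_block"
      using base_vector_in_base_block by (simp add: u\<^sub>1_def base_vector_def)
    show "- u\<^sub>1 \<in> Q"
      unfolding u\<^sub>1_def Q_def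
      by (subst minus_vector_of, simp, rule mem[where k = "[0, 1, - 1, - 1, 1]"]) (simp, simp, simp, code_simp, code_simp)
    show "u\<^sub>2 \<in> Q"
      unfolding u\<^sub>2_def Q_def
      by (rule mem[where k = "[- 1, 1, 0, 1, - 1]"]) (simp, simp, simp, code_simp, code_simp)
    show "- u\<^sub>2 \<in> R"
      unfolding u\<^sub>2_def R_def
      by (subst minus_vector_of, simp, rule mem[where k = "[- 1, 1, 0, 1, - 1]"]) (simp, simp, simp, code_simp, code_simp)
    show "u\<^sub>3 \<in> R"
      unfolding u\<^sub>3_def R_def
      by (rule mem[where k = "[1, - 1, - 1, 1, 0]"]) (simp, simp, simp, code_simp, code_simp)
    show "- u\<^sub>3 \<in> base_block"
      unfolding u\<^sub>3_def base_block_def by (subst minus_vector_of, simp, rule imageI) code_simp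
  qed
  have L: "u\<^sub>1 \<in> zero_sum" "u\<^sub>2 \<in> zero_sum" "u\<^sub>3 \<in> zero_sum"
    using u QR base_block_in_orbit block_in_zero_sum by blast+
  have walk: "((base_block, reduce n 0), (Q, reduce n (0 + u\<^sub>1))) \<in> cover_arcs n"
    "((Q, reduce n (0 + u\<^sub>1)), (R, reduce n (0 + u\<^sub>1 + u\<^sub>2))) \<in> cover_arcs n"
    "((R, reduce n (0 + u\<^sub>1 + u\<^sub>2)), (base_block, reduce n (0 + u\<^sub>1 + u\<^sub>2 + u\<^sub>3))) \<in> cover_arcs n"
    using cover_arcsI[OF base_block_in_orbit QR(1) zero_sum_zero u(1,2)]
      cover_arcsI[OF QR(1,2) zero_sum_add[OF zero_sum_zero L(1)] u(3,4)]
      cover_arcsI[OF QR(2) base_block_in_orbit zero_sum_add[OF zero_sum_add[OF zero_sum_zero L(1)] L(2)] u(5,6)]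
    by blast+
  have sum: "0 + u\<^sub>1 + u\<^sub>2 + u\<^sub>3 = scale 3 (unit_diff 2 4)"
  proof
    fix i :: nat
    consider "i = 1" | "i = 2" | "i = 3" | "i = 4" | "i = 5" | "i \<notin> {1..5}"
      by force
    then show "(0 + u\<^sub>1 + u\<^sub>2 + u\<^sub>3) i = scale 3 (unit_diff 2 4) i"
      by cases (auto simp: u\<^sub>1_def u\<^sub>2_def u\<^sub>3_def vector_of_def scale_def unit_diff_def)
  qed
  have "((base_block, reduce n 0), (base_block, reduce n (0 + u\<^sub>1 + u\<^sub>2 + u\<^sub>3))) \<in> (cover_arcs n)\<^sup>*"
    by (rule converse_rtrancl_into_rtrancl[OF walk(1)], rule converse_rtrancl_into_rtrancl[OF walk(2)],
        rule r_into_rtrancl[OF walk(3)])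
  moreover have "scale 3 (unit_diff 2 4) \<in> zero_sum"
    unfolding sum[symmetric] using L by (intro zero_sum_add zero_sum_zero)
  ultimately show ?thesis
    unfolding closed_walk_voltages_def sum by blast
qed

lemma signed_act_scale_unit_diff:
  assumes "\<sigma> permutes {1..5}"
  shows "signed_act \<sigma> (scale k (unit_diff i j)) = scale (sign \<sigma> * k) (unit_diff (\<sigma> i) (\<sigma> j))"
  by (rule signed_act_eqI[OF assms]) (simp add: scale_def unit_diff_def inj_eq[OF permutes_inj[OF assms]])

lemma triple_unit_diff_voltage:
  assumes "i \<in> {1..5}" "j \<in> {1..5}" "i \<noteq> j"
  shows "scale 3 (unit_diff i j) \<in> closed_walk_voltages n"
proof -
  \<comment> \<open>A permutation with 2 \<open>\<mapsto>\<close> \<open>i\<close> and 4 \<open>\<mapsto>\<close> \<open>j\<close>.\<close>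
  define \<sigma> where "\<sigma> = Transposition.transpose j (Transposition.transpose i 2 4) \<circ> Transposition.transpose i 2"
  have t: "Transposition.transpose i 2 4 \<in> {1..5}" "i \<noteq> Transposition.transpose i 2 4"
    using assms by (auto simp: transpose_def)
  have \<sigma>: "\<sigma> permutes {1..5}" "\<sigma> 2 = i" "\<sigma> 4 = j"
    unfolding \<sigma>_def using assms t
    by (auto intro!: permutes_compose permutes_swap_id simp: transpose_apply_other)
  have "scale (sign \<sigma> * 3) (unit_diff i j) \<in> closed_walk_voltages n"
    using closed_walk_voltages_signed_act[OF \<sigma>(1) triangle_voltage, of n] signed_act_scale_unit_diff[OF \<sigma>(1), of 3 2 4] \<sigma> by simp
  \<comment> \<open>If \<open>\<sigma>\<close> is odd, the closed walk obtained is traversed backwards.\<close>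
  then have "scale (sign \<sigma>) (scale (sign \<sigma> * 3) (unit_diff i j)) \<in> closed_walk_voltages n"
    by (rule closed_walk_voltages_scale)
  moreover have "scale (sign \<sigma>) (scale (sign \<sigma> * 3) (unit_diff i j)) = scale 3 (unit_diff i j)"
    by (simp add: scale_def flip: mult.assoc)
  ultimately show ?thesis by simp
qed

text \<open>The differences of unit vectors generate the zero-sum vectors, and symmetry supplies three times each
such difference from the one triangle.\<close>
lemma triple_lattice_voltage:
  assumes "x \<in> zero_sum"
  shows "scale 3 x \<in> closed_walk_voltages n"
proof -
  have "scale 3 x = scale (x 1) (scale 3 (unit_diff 1 5)) + scale (x 2) (scale 3 (unit_diff 2 5))
      + scale (x 3) (scale 3 (unit_diff 3 5)) + scale (x 4) (scale 3 (unit_diff 4 5))"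
    (is "_ = ?y")
  proof
    fix i :: nat
    have sum: "x 1 + x 2 + x 3 + x 4 + x 5 = 0" and zero: "i \<notin> {1..5} \<Longrightarrow> x i = 0"
      using assms unfolding zero_sum_def coordinates_eq by auto
    consider "i = 1" | "i = 2" | "i = 3" | "i = 4" | "i = 5" | "i \<notin> {1..5}"
      by force
    then show "scale 3 x i = ?y i"
      using sum zero by cases (auto simp: scale_def unit_diff_def)
  qed
  then show ?thesis
    by (simp only:) (intro closed_walk_voltages_add closed_walk_voltages_scale triple_unit_diff_voltage; simp)
qed

text \<open>Every zero-sum vector is congruent modulo \<open>n\<close> to three times a zero-sum vector, since 3 is
invertible modulo \<open>n\<close>. All vertices over the base block are therefore connected, and each block is
adjacent to the base block.\<close>
lemma cover_connected:
  assumes "coprime n 3" "p \<in> cover_vertices n" "q \<in> cover_vertices n"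
  shows "(p, q) \<in> (cover_arcs n)\<^sup>*"
proof -
  have from_base: "((base_block, reduce n 0), q) \<in> (cover_arcs n)\<^sup>*" if "q \<in> cover_vertices n" for q
    using that
  proof (rule cover_verticesE)
    fix Q x assume q: "q = (Q, reduce n x)" "Q \<in> block_orbit" "x \<in> zero_sum"
    obtain u where u: "u \<in> zero_sum" "((base_block, reduce n 0), (Q, reduce n u)) \<in> (cover_arcs n)\<^sup>*"
      using q(2) by (rule path_to_block)
    have y: "x - u \<in> zero_sum"
      using zero_sum_add[OF q(3) zero_sum_minus[OF u(1)]] by simp
    obtain m k where mk: "m * 3 + k * n = 1"
      using bezout_int[of 3 n] assms(1) by (auto simp: coprime_iff_gcd_eq_1 gcd.commute)
    let ?w = "scale 3 (scale m (x - u))"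
    have "reduce n ?w = reduce n (x - u)"
    proof
      fix i
      \<comment> \<open>The Bezout identity makes \<open>m\<close> an inverse of 3 modulo \<open>n\<close>.\<close>
    have "3 * (m * (x i - u i)) = (m * 3 + k * n) * (x i - u i) + n * (- k * (x i - u i))"
        by (simp add: algebra_simps)
      then have "3 * (m * (x i - u i)) = (x i - u i) + n * (- k * (x i - u i))"
        using mk by simp
      then show "reduce n ?w i = reduce n (x - u) i"
        by (simp add: reduce_def scale_def mod_mult_self2 del: mult_minus_left mult_minus_right)
    qed
    moreover have "?w \<in> closed_walk_voltages n"
      using y by (intro triple_lattice_voltage scale_in_zero_sum)
    ultimately have "((base_block, reduce n 0), (base_block, reduce n (x - u))) \<in> (cover_arcs n)\<^sup>*"
      by (simp add: closed_walk_voltages_def)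
    moreover have "((base_block, reduce n (x - u)), (Q, reduce n x)) \<in> (cover_arcs n)\<^sup>*"
      using translate_path[OF u(2) y] by simp
    ultimately show ?thesis
      using q(1) by simp
  qed
  then show ?thesis
    using assms sym_rtrancl[OF sym_cover_arcs] by (meson rtrancl_trans symD)
qed

section \<open>The quasi-semiregular rotation\<close>
text \<open>The rotation fixes only the base block, and a vector fixed modulo \<open>n\<close> by the 5-cycle is a constant
\<open>c\<close> with 5\<open>c\<close> divisible by \<open>n\<close>.\<close>
lemma rotation_fixed_vertex:
  assumes "coprime n 5" "p \<in> cover_vertices n" "affine n rot 0 p = p"
  shows "p = (base_block, reduce n 0)"
  using assms(2)
proof (rule cover_verticesE)
  fix P x assume p: "p = (P, reduce n x)" "P \<in> block_orbit" "x \<in> zero_sum"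
  have fixed: "signed_act rot ` P = P" "reduce n (signed_act rot x) = reduce n x"
    using assms(3) by (simp_all add: p affine_reduce)
  \<comment> \<open>The 5-cycle is even, so the action has no sign here.\<close>
  have step: "x i mod n = x (rot i) mod n" for i
    using fun_cong[OF fixed(2), of "rot i"] signed_act_apply[OF rot_permutes, of x i]
    by (simp add: reduce_def sign_rot)
  have const: "x i mod n = x 1 mod n" if "i \<in> {1..5}" for i
    using step[of 2] step[of 3] step[of 4] step[of 5] that unfolding coordinates_eq
    by (auto simp: rot_apply)
  have "(\<Sum>i=1..5. x i) mod n = (\<Sum>i=1..5. x i mod n) mod n"
    by (rule mod_sum_eq[symmetric])
  also have "(\<Sum>i=1..5. x i mod n) = (\<Sum>i=1..(5::nat). x 1 mod n)"
    by (intro sum.cong refl const)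
  also have "\<dots> mod n = (5 * x 1) mod n"
    by (simp add: mod_simps)
  finally have "n dvd 5 * x 1"
    using p(3) by (simp add: zero_sum_def mod_0_imp_dvd)
  then have "n dvd x 1"
    using assms(1) by (simp add: coprime_dvd_mult_right_iff)
  then have "x i mod n = 0" for i
    using const[of i] p(3) by (cases "i \<in> {1..5}") (auto simp: zero_sum_def)
  then have "reduce n x = reduce n 0"
    by (simp add: reduce_def fun_eq_iff)
  then show ?thesis
    using p rot_fixes_only_base_block[OF p(2) fixed(1)] by simp
qed

lemma rotation_order:
  assumes "p \<in> cover_vertices n"
  shows "(affine n rot 0 ^^ 5) p = p"
proof -
  have "(affine n rot 0 ^^ k) p = affine n (rot ^^ k) 0 p \<and> rot ^^ k permutes {1..5}" for k
  proof (induction k)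
    case 0
    have "(affine n rot 0 ^^ 0) p = affine n (rot ^^ 0) 0 p" "rot ^^ 0 permutes {1..5}"
      using affine_id[OF assms] by (simp_all add: permutes_id)
    then show ?case by blast
  next
    case (Suc k)
    then have "affine n rot 0 ((affine n rot 0 ^^ k) p) = affine n (rot \<circ> rot ^^ k) 0 p"
      using affine_comp[OF rot_permutes, of "rot ^^ k" n 0 0 p] by (metis signed_act_zero add_0)
    moreover have "rot \<circ> rot ^^ k permutes {1..5}"
      using Suc by (intro permutes_compose[OF _ rot_permutes]) simp
    ultimately show ?case
      unfolding funpow.simps comp_apply[of _ _ p] by blast
  qed
  then show ?thesis
    using affine_id[OF assms] by (simp add: rot_power_5)
qed

text \<open>An element whose fifth power fixes \<open>u\<close> has an orbit of length 1 or 5 at \<open>u\<close>, as 5 is prime.\<close>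
lemma card_orbit_order_5:
  assumes "(g ^^ 5) u = u" "g u \<noteq> u"
  shows "card (Orbits.orbit g u) = 5"
proof -
  have shift: "(g ^^ (k + 5)) u = (g ^^ k) u" for k
    using assms(1) by (simp add: funpow_add)
  have shifts: "(g ^^ (k + 5 * m)) u = (g ^^ k) u" for k m
  proof (induction m)
    case (Suc m)
    have "k + 5 * Suc m = k + 5 * m + 5" by simp
    then show ?case using Suc shift[of "k + 5 * m"] by metis
  qed simp
  have ne: "(g ^^ d) u \<noteq> u" if "0 < d" "d < 5" for d
  proof
    assume d: "(g ^^ d) u = u"
    have multiple: "(g ^^ (d * k)) u = u" for k
      by (induction k) (simp_all add: d funpow_add)
    have "d = 1 \<or> d = 2 \<or> d = 3 \<or> d = 4"
      using that by auto
    \<comment> \<open>An inverse of \<open>d\<close> modulo 5 turns \<open>g ^^ d\<close> into \<open>g\<close> on the orbit.\<close>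
    then have "d * 1 = 1 + 5 * 0 \<or> d * 3 = 1 + 5 * 1 \<or> d * 2 = 1 + 5 * 1 \<or> d * 4 = 1 + 5 * 3"
      by auto
    then obtain k m where "d * k = 1 + 5 * m"
      by blast
    then have "g u = u"
      using multiple[of k] shifts[of 1 m] by simp
    then show False
      using assms(2) by contradiction
  qed
  have "inj_on (\<lambda>m. (g ^^ m) u) {..<5}"
  proof (rule linorder_inj_onI')
    fix i j :: nat assume ij: "i \<in> {..<5}" "j \<in> {..<5}" "i < j"
    show "(g ^^ i) u \<noteq> (g ^^ j) u"
    proof
      assume eq: "(g ^^ i) u = (g ^^ j) u"
      have "(g ^^ (5 - i)) ((g ^^ i) u) = (g ^^ (5 - i + i)) u"
        by (simp add: funpow_add)
      moreover have "(g ^^ (5 - i)) ((g ^^ j) u) = (g ^^ (5 - i + j)) u"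
        by (simp add: funpow_add)
      moreover have "5 - i + i = 5" "5 - i + j = (j - i) + 5"
        using ij by auto
      ultimately have "(g ^^ (j - i)) u = u"
        using eq shift[of "j - i"] assms(1) by simp
      then show False
        using ne[of "j - i"] ij by (simp add: less_imp_diff_less)
    qed
  qed
  moreover have "Orbits.orbit g u = (\<lambda>m. (g ^^ m) u) ` {..<5}"
    using orbit_altdef_bounded[OF assms(1)] by auto
  ultimately show ?thesis
    by (simp add: card_image)
qed

text \<open>The cover is transported along a labelling \<open>c\<close> of its vertices because the vertices are pairs of a
set and a function, whereas the family is to live on natural numbers.\<close>
definition cover :: "int \<Rightarrow> ((nat \<Rightarrow> int) set \<times> (nat \<Rightarrow> int) \<Rightarrow> 'a) \<Rightarrow> 'a pair_pre_digraph" where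
  "cover n c = relabel c (cover_vertices n) (cover_arcs n)"

definition lift_affine :: "int \<Rightarrow> ((nat \<Rightarrow> int) set \<times> (nat \<Rightarrow> int) \<Rightarrow> 'a) \<Rightarrow> (nat \<Rightarrow> nat) \<Rightarrow> (nat \<Rightarrow> int) \<Rightarrow> 'a \<Rightarrow> 'a"
  where "lift_affine n c \<sigma> w = relabel_map c (cover_vertices n) (affine n \<sigma> w)"

lemma pverts_cover: "pverts (cover n c) = c ` cover_vertices n"
  by (simp add: cover_def)

lemma lift_affine_apply:
  "inj_on c (cover_vertices n) \<Longrightarrow> p \<in> cover_vertices n \<Longrightarrow> lift_affine n c \<sigma> w (c p) = c (affine n \<sigma> w p)"
  by (simp add: lift_affine_def)

lemma lift_affine_automorphism:
  assumes "inj_on c (cover_vertices n)" "\<sigma> permutes {1..5}" "w \<in> zero_sum"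
  shows "lift_affine n c \<sigma> w \<in> carrier (graph_aut_group (cover n c))"
proof -
  have inv: "inv' \<sigma> permutes {1..5}"
    using assms(2) by (rule permutes_inv)
  then have inv_w: "- signed_act (inv' \<sigma>) w \<in> zero_sum"
    using assms(3) by (intro zero_sum_minus zero_sum_signed_act)
  show ?thesis
    unfolding lift_affine_def cover_def
    by (rule relabel_map_automorphism[OF assms(1) cover_arcs_subset,
          where \<psi> = "affine n (inv' \<sigma>) (- signed_act (inv' \<sigma>) w)"])
       (use assms inv inv_w affine_cover_vertices affine_cover_arcs affine_inverse in auto)
qed

lemma cover_symmetric_graph:
  assumes "inj_on c (cover_vertices n)"
  shows "symmetric_graph (cover n c)"
proof -
  let ?A = "carrier (graph_aut_group (cover n c))"
  have arc: "\<exists>f \<in> ?A. f (c p) = c p' \<and> f (c q) = c q'"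
    if "(p, q) \<in> cover_arcs n" "(p', q') \<in> cover_arcs n" for p q p' q'
  proof -
    obtain \<sigma> w where *: "\<sigma> permutes {1..5}" "w \<in> zero_sum" "affine n \<sigma> w p = p'" "affine n \<sigma> w q = q'"
      using \<open>(p, q) \<in> cover_arcs n\<close> \<open>(p', q') \<in> cover_arcs n\<close> by (rule affine_arc_transitive)
    moreover have "p \<in> cover_vertices n" "q \<in> cover_vertices n"
      using that cover_arcs_subset by blast+
    ultimately show ?thesis
      using lift_affine_automorphism[OF assms *(1,2)] lift_affine_apply[OF assms] by metis
  qed
  have "\<exists>q. (p, q) \<in> cover_arcs n" if "p \<in> cover_vertices n" for p
  proof -
    have "{q. (p, q) \<in> cover_arcs n} \<noteq> {}"
      using card_out_neighbours[OF that] by force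
    then show ?thesis by blast
  qed
  then have "vertex_transitive (cover n c)"
    unfolding vertex_transitive_def pverts_cover using arc by blast
  moreover have "arc_transitive (cover n c)"
    unfolding arc_transitive_def using arc by (auto simp: cover_def relabel_def)
  ultimately show ?thesis
    by (simp add: symmetric_graph_def)
qed

lemma cover_quasi_semiregular:
  assumes c: "inj_on c (cover_vertices n)" and n: "coprime n 5"
  shows "quasi_semiregular (cover n c) (lift_affine n c rot 0)"
proof -
  let ?g = "lift_affine n c rot 0" and ?p = "(base_block, reduce n 0)"
  have g: "?g \<in> carrier (graph_aut_group (cover n c))"
    by (rule lift_affine_automorphism[OF c rot_permutes zero_sum_zero])
  have p: "?p \<in> cover_vertices n"
    by (simp add: cover_vertices_def base_block_in_orbit zero_sum_zero)
  have fixed: "?g (c ?p) = c ?p"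
    using p c by (simp add: lift_affine_apply affine_reduce rot_fixes_base_block)
  have moved: "?g u \<noteq> u" if u: "u \<in> c ` cover_vertices n - {c ?p}" for u
  proof
    assume eq: "?g u = u"
    obtain q where q: "q \<in> cover_vertices n" "u = c q" "q \<noteq> ?p"
      using u by blast
    have "affine n rot 0 q = q"
      using eq q lift_affine_apply[OF c] c affine_cover_vertices[OF rot_permutes zero_sum_zero q(1)]
      by (metis inj_onD)
    then show False
      using rotation_fixed_vertex[OF n q(1)] q(3) by blast
  qed
  have orbit: "card (Orbits.orbit ?g u) = 5" if u: "u \<in> c ` cover_vertices n - {c ?p}" for u
  proof (rule card_orbit_order_5)
    obtain q where q: "q \<in> cover_vertices n" "u = c q"
      using u by blast
    have "(?g ^^ 5) (c q) = c ((affine n rot 0 ^^ 5) q)"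
      unfolding lift_affine_def
      by (rule relabel_map_funpow[OF c affine_cover_vertices[OF rot_permutes zero_sum_zero] q(1)])
    then show "(?g ^^ 5) u = u"
      using q rotation_order by metis
    show "?g u \<noteq> u"
      using u by (rule moved)
  qed
  have "\<exists>u. u \<in> c ` cover_vertices n - {c ?p}"
  proof -
    obtain Q where Q: "Q \<in> block_orbit" "- base_vector \<in> Q"
      using neg_in_some_block base_block_in_orbit base_vector_in_base_block by blast
    then have "Q \<noteq> base_block"
      using neg_notin_block[OF base_block_in_orbit base_vector_in_base_block] by blast
    moreover have "(Q, reduce n 0) \<in> cover_vertices n"
      using Q by (simp add: cover_vertices_def zero_sum_zero)
    ultimately show ?thesis
      using c p by (intro exI[of _ "c (Q, reduce n 0)"]) (auto dest: inj_onD)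
  qed
  then obtain u where u: "u \<in> c ` cover_vertices n - {c ?p}" by blast
  have "\<one>\<^bsub>graph_aut_group (cover n c)\<^esub> u = u"
    using u by (simp add: graph_aut_group_def BijGroup_def pverts_cover)
  then have "?g \<noteq> \<one>\<^bsub>graph_aut_group (cover n c)\<^esub>"
    using moved[OF u] by metis
  then show ?thesis
    unfolding quasi_semiregular_def pverts_cover using g p fixed moved orbit
    by (intro conjI bexI[of _ "c ?p"]) auto
qed

section \<open>Insolvability\<close>
lemma graph_aut_group_mult:
  assumes "f \<in> carrier (graph_aut_group G)" "g \<in> carrier (graph_aut_group G)"
  shows "f \<otimes>\<^bsub>graph_aut_group G\<^esub> g = compose (pverts G) f g"
  using assms by (simp add: graph_aut_group_def graph_automorphisms_def BijGroup_def)

lemma lift_affine_hom: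
  assumes c: "inj_on c (cover_vertices n)"
  shows "group_hom (sym_group 5) (graph_aut_group (cover n c)) (\<lambda>\<sigma>. lift_affine n c \<sigma> 0)"
proof -
  have "(\<lambda>\<sigma>. lift_affine n c \<sigma> 0) \<in> hom (sym_group 5) (graph_aut_group (cover n c))"
  proof (rule homI)
    fix \<sigma> \<tau> assume "\<sigma> \<in> carrier (sym_group 5)" "\<tau> \<in> carrier (sym_group 5)"
    then have perm: "\<sigma> permutes {1..5}" "\<tau> permutes {1..5}"
      by (simp_all add: sym_group_carrier)
    have "affine n \<sigma> 0 \<circ> affine n \<tau> 0 = affine n (\<sigma> \<circ> \<tau>) 0"
    proof
      fix p
      show "(affine n \<sigma> 0 \<circ> affine n \<tau> 0) p = affine n (\<sigma> \<circ> \<tau>) 0 p"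
        using affine_comp[OF perm, of n 0 0 p] by simp
    qed
    then have "compose (c ` cover_vertices n) (lift_affine n c \<sigma> 0) (lift_affine n c \<tau> 0) = lift_affine n c (\<sigma> \<circ> \<tau>) 0"
      unfolding lift_affine_def
      using relabel_map_compose[OF c, of "affine n \<tau> 0" "affine n \<sigma> 0"]
        affine_cover_vertices[OF perm(2) zero_sum_zero] by auto
    then show "lift_affine n c (\<sigma> \<otimes>\<^bsub>sym_group 5\<^esub> \<tau>) 0 =
        lift_affine n c \<sigma> 0 \<otimes>\<^bsub>graph_aut_group (cover n c)\<^esub> lift_affine n c \<tau> 0"
      using perm lift_affine_automorphism[OF c _ zero_sum_zero]
      by (simp add: graph_aut_group_mult sym_group_mult pverts_cover)
  qed (simp add: sym_group_carrier lift_affine_automorphism[OF c _ zero_sum_zero])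
  then show ?thesis
    by (simp add: group_hom_def group_hom_axioms_def sym_group_is_group group_graph_aut_group)
qed

text \<open>A signed permutation can be read off modulo \<open>n\<close> from where it moves the only zero of such a vector;
this makes the action of the symmetric group on the cover faithful.\<close>
lemma exists_one_zero_vector:
  assumes "n > 1" "a \<in> {1..5}"
  obtains x where "x \<in> zero_sum" "\<And>i. i \<in> {1..5} \<Longrightarrow> n dvd x i \<longleftrightarrow> i = a"
proof
  let ?\<tau> = "Transposition.transpose 1 a"
  have \<tau>: "?\<tau> permutes {1..5}"
    using assms(2) by (intro permutes_swap_id) auto
  then show "signed_act ?\<tau> base_vector \<in> zero_sum"
    by (rule zero_sum_signed_act[OF _ base_vector_in_zero_sum])
  fix i :: nat assume i: "i \<in> {1..5}"
  have base: "n dvd base_vector j \<longleftrightarrow> j = 1" if "j \<in> {1..5}" for j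
    using that assms(1) unfolding coordinates_eq base_vector_def vector_of_def by auto
  have "?\<tau> i \<in> {1..5}"
    using \<tau> i by (simp only: permutes_in_image)
  then have "n dvd sign ?\<tau> * base_vector (?\<tau> i) \<longleftrightarrow> ?\<tau> i = 1"
    using base by (cases ?\<tau> rule: sign_cases) simp_all
  moreover have "signed_act ?\<tau> base_vector i = sign ?\<tau> * base_vector (?\<tau> i)"
    by (simp add: signed_act_def)
  moreover have "?\<tau> i = 1 \<longleftrightarrow> i = a"
    by (auto simp: transpose_def)
  ultimately show "n dvd signed_act ?\<tau> base_vector i \<longleftrightarrow> i = a"
    by simp
qed

lemma lift_affine_inj:
  assumes c: "inj_on c (cover_vertices n)" and n: "n > 1"
  shows "inj_on (\<lambda>\<sigma>. lift_affine n c \<sigma> 0) (carrier (sym_group 5))"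
proof (rule inj_onI)
  fix \<sigma> \<tau> assume "\<sigma> \<in> carrier (sym_group 5)" "\<tau> \<in> carrier (sym_group 5)"
    and eq: "lift_affine n c \<sigma> 0 = lift_affine n c \<tau> 0"
  then have perm: "\<sigma> permutes {1..5}" "\<tau> permutes {1..5}"
    by (simp_all add: sym_group_carrier)
  have "\<sigma> a = \<tau> a" if a: "a \<in> {1..5}" for a
  proof -
    obtain x where x: "x \<in> zero_sum" "\<And>i. i \<in> {1..5} \<Longrightarrow> n dvd x i \<longleftrightarrow> i = a"
      using exists_one_zero_vector[OF n a] by blast
    have p: "(base_block, reduce n x) \<in> cover_vertices n"
      using x(1) by (simp add: cover_vertices_def base_block_in_orbit)
    have "affine n \<sigma> 0 (base_block, reduce n x) = affine n \<tau> 0 (base_block, reduce n x)"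
      using fun_cong[OF eq, of "c (base_block, reduce n x)"] p c perm affine_cover_vertices[OF _ zero_sum_zero p]
      by (simp add: lift_affine_apply inj_on_eq_iff)
    then have "reduce n (signed_act \<sigma> x) = reduce n (signed_act \<tau> x)"
      by (simp add: affine_reduce)
    then have "signed_act \<sigma> x (\<sigma> a) mod n = signed_act \<tau> x (\<sigma> a) mod n"
      unfolding reduce_def by (rule fun_cong)
    moreover have "n dvd signed_act \<sigma> x (\<sigma> a)"
      using x(2)[OF a] by (simp add: signed_act_apply[OF perm(1)])
    ultimately have "n dvd signed_act \<tau> x (\<sigma> a)"
      by (simp add: dvd_eq_mod_eq_0)
    then have "n dvd x (inv' \<tau> (\<sigma> a))"
      by (cases \<tau> rule: sign_cases) (simp_all add: signed_act_def)
    moreover have "inv' \<tau> (\<sigma> a) \<in> {1..5}"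
      using a perm permutes_inv[OF perm(2)] by (simp only: permutes_in_image)
    ultimately have "inv' \<tau> (\<sigma> a) = a"
      using x(2) by blast
    then show ?thesis
      using perm(2) by (metis permutes_inverses(1))
  qed
  then show "\<sigma> = \<tau>"
    using perm by (metis ext permutes_not_in)
qed

text \<open>The alternating group of degree 5 is a nontrivial perfect subgroup.\<close>
lemma sym_group_5_not_solvable: "\<not> solvable (sym_group 5)"
proof
  interpret S: Group.group "sym_group 5" by (rule sym_group_is_group)
  interpret A: Group.group "alt_group 5" by (rule alt_group_is_group)
  assume "solvable (sym_group 5)"
  have hom: "group_hom (alt_group 5) (sym_group 5) id"
    by (simp add: group_hom_def group_hom_axioms_def S.group_axioms A.group_axioms hom_def
        alt_group_carrier sym_group_carrier alt_group_mult sym_group_mult)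
  have "solvable (alt_group 5)"
    using group_hom.inj_hom_imp_solvable[OF hom] \<open>solvable (sym_group 5)\<close> by simp
  then obtain k where k: "(derived (alt_group 5) ^^ k) (carrier (alt_group 5)) = {\<one>\<^bsub>alt_group 5\<^esub>}"
    using A.solvable_iff_trivial_derived_seq by blast
  have "(derived (alt_group 5) ^^ k) (carrier (alt_group 5)) = carrier (alt_group 5)"
    by (induction k) (simp_all add: derived_alt_group_const)
  then have "carrier (alt_group 5) = {\<one>\<^bsub>alt_group 5\<^esub>}"
    using k by metis
  then have "card (carrier (alt_group 5)) = 1"
    by simp
  moreover have "2 * card (carrier (alt_group 5)) = fact 5"
    using alt_group_card_carrier[of 5] by simp
  moreover have "fact 5 = (120 :: nat)"
    by (simp add: fact_numeral)
  ultimately show False by simp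
qed

lemma cover_not_solvable:
  assumes "inj_on c (cover_vertices n)" "n > 1"
  shows "\<not> solvable (graph_aut_group (cover n c))"
  using group_hom.inj_hom_imp_solvable[OF lift_affine_hom[OF assms(1)] lift_affine_inj[OF assms]]
    sym_group_5_not_solvable by blast

section \<open>An infinite family\<close>
text \<open>A lower bound tending to infinity suffices to separate the isomorphism types; the multiples of one
difference of unit vectors over one block provide it.\<close>
lemma card_cover_vertices_ge:
  assumes "n > 0"
  shows "nat n \<le> card (cover_vertices n)"
proof -
  let ?f = "\<lambda>t. (base_block, reduce n (scale t (unit_diff 1 2)))"
  have "unit_diff 1 2 \<in> zero_sum"
    unfolding zero_sum_def coordinates_eq by (auto simp: unit_diff_def)
  then have "?f ` {0..<n} \<subseteq> cover_vertices n"
    by (auto simp: cover_vertices_def base_block_in_orbit scale_in_zero_sum)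
  moreover have "inj_on ?f {0..<n}"
  proof (rule inj_onI)
    fix s t assume st: "s \<in> {0..<n}" "t \<in> {0..<n}" "?f s = ?f t"
    then have "reduce n (scale s (unit_diff 1 2)) 1 = reduce n (scale t (unit_diff 1 2)) 1"
      by simp
    then show "s = t"
      using st(1,2) by (simp add: reduce_def scale_def unit_diff_def)
  qed
  ultimately have "card {0..<n} \<le> card (cover_vertices n)"
    using card_inj_on_le finite_cover_vertices[OF assms] by blast
  then show ?thesis by simp
qed

lemma digraph_iso_card_verts:
  assumes "digraph_iso G H"
  shows "card (verts H) = card (verts G)"
  using assms by (auto simp: digraph_iso_def pre_digraph.digraph_isomorphism_def card_image)

theorem theorem1p3:
  shows "\<exists>\<G> :: nat pair_pre_digraph set.
    infinite \<G> \<and>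
    (\<forall>G \<in> \<G>. \<forall>H \<in> \<G>. G \<noteq> H \<longrightarrow> \<not> digraph_iso (with_proj G) (with_proj H)) \<and>
    (\<forall>G \<in> \<G>.
       pair_graph G \<and>
       Digraph_Component.connected (with_proj G) \<and>
       pentavalent G \<and>
       symmetric_graph G \<and>
       (\<exists>g. quasi_semiregular G g) \<and>
       \<not> solvable (graph_aut_group G))"
proof -
  define good :: "nat pair_pre_digraph \<Rightarrow> bool" where
    "good G \<longleftrightarrow> pair_graph G \<and> Digraph_Component.connected (with_proj G) \<and> pentavalent G \<and>
       symmetric_graph G \<and> (\<exists>g. quasi_semiregular G g) \<and> \<not> solvable (graph_aut_group G)" for G
  have large: "\<exists>G. good G \<and> m \<le> card (pverts G)" for m
  proof -
    \<comment> \<open>Congruent to 1 modulo 15, greater than 1 and at least \<open>m\<close>.\<close>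
    define n where "n = 15 * int m + 16"
    have n: "n > 1" by (simp add: n_def)
    have "gcd n 15 = gcd (15 * (int m + 1) + 1) 15"
      by (simp add: n_def algebra_simps)
    also have "\<dots> = 1"
      by (metis gcd.commute gcd_add_mult gcd_1_int mult.commute)
    finally have "coprime n 15"
      by (simp add: coprime_iff_gcd_eq_1)
    then have co: "coprime n 3" "coprime n 5"
      using coprime_mult_right_iff[of n 3 5] by simp_all
    obtain c :: "(nat \<Rightarrow> int) set \<times> (nat \<Rightarrow> int) \<Rightarrow> nat" where c: "inj_on c (cover_vertices n)"
      using finite_imp_inj_to_nat_seg[OF finite_cover_vertices[of n]] n by auto
    have ne: "cover_vertices n \<noteq> {}"
      using base_block_in_orbit zero_sum_zero by (auto simp: cover_vertices_def)
    have "pair_graph (cover n c)"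
      unfolding cover_def
      using n by (intro relabel_pair_graph finite_cover_vertices cover_arcs_subset c sym_cover_arcs irrefl_cover_arcs) simp
    moreover have "Digraph_Component.connected (with_proj (cover n c))"
      unfolding cover_def by (rule relabel_connected[OF ne cover_arcs_subset cover_connected[OF co(1)]])
    moreover have "pentavalent (cover n c)"
      unfolding pentavalent_def cover_def
      by (auto simp: relabel_out_degree[OF c cover_arcs_subset] card_out_neighbours)
    ultimately have "good (cover n c)"
      unfolding good_def
      using cover_symmetric_graph[OF c] cover_quasi_semiregular[OF c co(2)] cover_not_solvable[OF c n]
      by blast
    moreover have "m \<le> card (pverts (cover n c))"
      using card_cover_vertices_ge[of n] n c by (simp add: pverts_cover card_image n_def)
    ultimately show ?thesis by blast
  qed
  \<comment> \<open>One graph for each number of vertices that occurs: isomorphic graphs have equally many.\<close>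
  define S where "S = {card (pverts G) | G. good G}"
  define pick where "pick k = (SOME G. good G \<and> card (pverts G) = k)" for k
  have pick: "good (pick k)" "card (pverts (pick k)) = k" if "k \<in> S" for k
    using that someI_ex[of "\<lambda>G. good G \<and> card (pverts G) = k"] by (auto simp: S_def pick_def)
  have "infinite S"
    unfolding infinite_nat_iff_unbounded_le S_def using large by blast
  moreover have "inj_on pick S"
    by (rule inj_onI) (metis pick(2))
  ultimately have "infinite (pick ` S)"
    by (simp add: finite_image_iff)
  moreover have "\<not> digraph_iso (with_proj G) (with_proj H)" if "G \<in> pick ` S" "H \<in> pick ` S" "G \<noteq> H" for G H
    using that pick(2) digraph_iso_card_verts[of "with_proj G" "with_proj H"] by auto
  ultimately show ?thesis
    using pick(1) unfolding good_def by (intro exI[of _ "pick ` S"]) blast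
qed

end
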